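(* Let $H=(\mathcal X,\mathcal F,\mathcal G,\varphi,r)$ be a metric hybrid system such that: $H$ is deterministic; for every $x\in\mathcal X$ there is an infinite or Zeno execution starting at $x$; $H$ satisfies the trapping guard condition; and $\mathcal X$ is compact. Then the hybrid chain recurrent set $R(H)$ admits a Conley decomposition: $$R(H)=\bigcap\{A\cup A^*\mid A \text{ is an attracting set for } H\}.$$ Furthermore, $x,y\in\mathcal X$ are chain equivalent if and only if, for every attracting-repelling pair $(A,A^* )$ for $H$, either $x,y\in A$ or $x,y\in A^*$.
   Context: **Hybrid systems.** A local semiflow $\varphi$ on a topological space $\mathcal F$ is a map $\varphi\colon\mathrm{dom}(\varphi)\to\mathcal F$ defined on an open neighborhood $\mathrm{dom}(\varphi)\subseteq[0,\infty)\times\mathcal F$ of $\{0\}\times\mathcal F$ such that, writing $\varphi^t=\varphi(t,\cdot)$, for $t,s\ge 0$: (i) $\varphi^0=\mathrm{id}_{\mathcal F}$; (ii) $(t+s,x)\in\mathrm{dom}(\varphi)$ iff both $(s,x)\in\mathrm{dom}(\varphi)$ and $(t,\varphi^s(x))\in\mathrm{dom}(\varphi)$; (iii) $\varphi^{t+s}(x)=\varphi^t(\varphi^s(x))$ for all $(t+s,x)\in\mathrm{dom}(\varphi)$. It is a semiflow if $\mathrm{dom}(\varphi)=[0,\infty)\times\mathcal F$. A topological hybrid system (THS) $H=(\mathcal X,\mathcal F,\mathcal G,\varphi,r)$ consists of a topological space $\mathcal X$ (state space), an open set $\mathcal F\subseteq\mathcal X$ (flow set) with a continuous local semiflow $\varphi$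 on $\mathcal F$, a closed set $\mathcal G\subseteq\mathcal X$ (guard), and a continuous map $r\colon\mathcal G\to\mathcal X$ (reset). If the topology of $\mathcal X$ arises from an extended metric $\mathrm{dist}\colon\mathcal X\times\mathcal X\to[0,+\infty]$, then $H$ together with $\mathrm{dist}$ is a metric hybrid system (MHS). **Executions.** An execution in $H$ is a tuple $\chi=(N,\tau,\gamma)$ with $N\in\mathbb N_{\ge0}\cup\{+\infty\}$; a nondecreasing sequence $\tau=(\tau_j)_{j=0}^{N+1}\subseteq\mathbb R\cup\{+\infty\}$ with $\tau_0=0$ and $(\tau_j)_{j=0}^N\subseteq\mathbb R$; and continuous maps $\gamma_j\colon T_j\to\mathcal X$ ($0\le j<N+1$) with $[\tau_j,\tau_{j+1})\subseteq T_j\subseteq[\tau_j,\tau_{j+1}]\cap\mathbb R$, such that $\gamma_j([\tau_j,\tau_{j+1}))\subseteq\mathcal F$ and $\gamma_j|_{[\tau_j,\tau_{j+1})}$ is a trajectory segment of $\varphi$ (i.e. $\gamma_j(t)=\varphi^{t-\tau_j}(\gamma_j(\tau_j))$); for $0\le j<N$ one additionally requires $T_j=[\tau_j,\tau_{j+1}]$, $\gamma_j(\tau_{j+1})\in\mathcal G$ and $\gamma_{j+1}(\tau_{j+1})=r(\gamma_j(\tau_{j+1}))$. (If $\tau_j=\tau_{j+1}$ the $\mathcal F$-condition is vacuous.) It starts at $\gamma_0(0)$. Its stop time is $\tau_{N+1}$ if $N<\infty$ and $\lim_{j\to\infty}\tau_j$ if $N=\infty$. It is infinite if the stop time is infinite,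 and Zeno if the stop time is finite and $N=\infty$. $\mathcal E_H(x)$ is the set of executions starting at $x$, and $\chi(t)=\{\gamma_j(t)\mid 0\le j<N+1,\ t\in T_j\}$. **Assumption terminology.** $H$ is deterministic if $\mathcal G\cap\mathcal F=\varnothing$. The maximum flow time $\mu\colon\mathcal X\to[0,+\infty]$ is $\mu(x)=\sup\{t\ge0:(t,x)\in\mathrm{dom}(\varphi)\}$ for $x\in\mathcal F$ and $\mu(x)=0$ for $x\notin\mathcal F$. A deterministic THS satisfies the trapping guard condition if there are a neighborhood $U\subseteq\mathcal X$ of $\mathcal G$ and a continuous retraction $\rho\colon U\to\mathcal G$ ($\rho|_{\mathcal G}=\mathrm{id}$) such that (i) $\mu|_U$ is a continuous real-valued function and (ii) with $\mathrm{cl}(\mathrm{dom}(\varphi))$ the closure of $\mathrm{dom}(\varphi)$ in $[0,\infty)\times\mathcal X$, the map $\varphi|_{\mathrm{dom}(\varphi)\cap([0,\infty)\times U)}$ admits a unique continuous extension $\widehat\varphi$ to $\mathrm{cl}(\mathrm{dom}(\varphi))\cap([0,\infty)\times U)$, given by $\widehat\varphi(t,x)=\varphi^t(x)$ if $(t,x)\in\mathrm{dom}(\varphi)$, $x\in U$, and $\widehat\varphi(t,x)=\rho(x)$ if $x\in U$, $t=\mu(x)$. **Chains.** For an MHS $H$ and $\epsilon,T\ge0$, an $(\epsilon,T)$-chain is a tuple $\chi=(N,\tau,\eta,\gamma)$ with $N\in\mathbb N_{\ge1}$; a nondecreasing real sequence $\tau=(\tau_j)_{j=0}^{N+1}$,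 $\tau_0=0$; indices $0=\eta_0<\eta_1<\dots<\eta_M\le N$ with $\tau_{\eta_k}-\tau_{\eta_{k-1}}\ge T$ for all $k\ge1$; and continuous $\gamma_j\colon[\tau_j,\tau_{j+1}]\to\mathcal X$ ($0\le j\le N$) with $\gamma_j([\tau_j,\tau_{j+1}))\subseteq\mathcal F$ and $\gamma_j|_{[\tau_j,\tau_{j+1})}$ a trajectory segment of $\varphi$, such that: if $j=\eta_k$ for some $k\ge1$, then $\gamma_{j-1}(\tau_j)\in\mathcal F$ and $\mathrm{dist}(\gamma_j(\tau_j),\gamma_{j-1}(\tau_j))\le\epsilon$; if $1\le j\le N$ and $j\ne\eta_k$ for every $k$, then $\gamma_{j-1}(\tau_j)\in\mathcal G$ and $\mathrm{dist}(\gamma_j(\tau_j),r(\gamma_{j-1}(\tau_j)))\le\epsilon$. It goes from $\gamma_0(0)$ to $\gamma_N(\tau_{N+1})$. The Conley relation $\mathcal Ch_H(x,y)$ holds iff for all $\epsilon,T>0$ there is an $(\epsilon,T)$-chain from $x$ to $y$. $R(H)=\{x:\mathcal Ch_H(x,x)\}$ is the (hybrid) chain recurrent set; $x,y$ are chain equivalent if $\mathcal Ch_H(x,y)$ and $\mathcal Ch_H(y,x)$. **Limit sets and attracting-repelling pairs.** For $U\subseteq\mathcal X$, $\omega(U)=\bigcap_{T>0}\mathrm{cl}\big(\bigcup_{x\in U}\bigcup_{(N,\tau,\gamma)\in\mathcal E_H(x)}\{\gamma_j(t)\mid j+t\ge T\}\big)$, and $\omega(x)=\omega(\{x\})$. A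 set $S$ is forward invariant if $\chi(t)\subseteq S$ for all $x\in S$, $\chi\in\mathcal E_H(x)$, $t\ge0$. A precompact set $U\subseteq\mathcal X$ is a trapping set if it is forward invariant and there is $T>0$ with $\mathrm{cl}\big(\bigcup_{x\in U}\bigcup_{(N,\tau,\gamma)\in\mathcal E_H(x)}\{\gamma_j(t)\mid j+t\ge T\}\big)\subseteq\mathrm{int}(U)$. The attracting set determined by a trapping set $U$ is $A=\omega(U)$; its dual repelling set is $A^*=\{x\in\mathcal X\mid\omega(x)\cap A=\varnothing\}$; $(A,A^* )$ is then an attracting-repelling pair. *)

theory Defs
  imports "HOL-Analysis.Analysis"
begin

text \<open>
  The state space of a hybrid system is the whole type \<open>'a\<close>.  The functions \<open>flow H\<close> and
  \<open>reset H\<close> are total, but only their values on \<open>flow_dom H\<close> and on \<open>guard H\<close> are meaningful.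
\<close>

record 'a hybrid_system =
  flow_set :: "'a set"
  guard :: "'a set"
  flow_dom :: "(real \<times> 'a) set"
  flow :: "real \<Rightarrow> 'a \<Rightarrow> 'a"
  reset :: "'a \<Rightarrow> 'a"

definition local_semiflow ::
  "'a::topological_space set \<Rightarrow> (real \<times> 'a) set \<Rightarrow> (real \<Rightarrow> 'a \<Rightarrow> 'a) \<Rightarrow> bool" where
  "local_semiflow F D \<phi> \<longleftrightarrow>
     openin (top_of_set ({0..} \<times> F)) D \<and>
     {0} \<times> F \<subseteq> D \<and>
     (\<forall>(t, x) \<in> D. \<phi> t x \<in> F) \<and>
     (\<forall>x\<in>F. \<phi> 0 x = x) \<and>
     (\<forall>t\<ge>0. \<forall>s\<ge>0. \<forall>x. (t + s, x) \<in> D \<longleftrightarrow> (s, x) \<in> D \<and> (t, \<phi> s x) \<in> D) \<and>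
     (\<forall>t\<ge>0. \<forall>s\<ge>0. \<forall>x. (t + s, x) \<in> D \<longrightarrow> \<phi> (t + s) x = \<phi> t (\<phi> s x))"

definition topological_hybrid_system :: "'a::topological_space hybrid_system \<Rightarrow> bool" where
  "topological_hybrid_system H \<longleftrightarrow>
     open (flow_set H) \<and>
     local_semiflow (flow_set H) (flow_dom H) (flow H) \<and>
     continuous_on (flow_dom H) (\<lambda>(t, x). flow H t x) \<and>
     closed (guard H) \<and>
     continuous_on (guard H) (reset H)"

definition extended_metric :: "('a \<Rightarrow> 'a \<Rightarrow> ennreal) \<Rightarrow> bool" where
  "extended_metric d \<longleftrightarrow>
     (\<forall>x y. d x y = 0 \<longleftrightarrow> x = y) \<and>
     (\<forall>x y. d x y = d y x) \<and>
     (\<forall>x y z. d x z \<le> d x y + d y z)"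

definition induces_topology :: "('a::topological_space \<Rightarrow> 'a \<Rightarrow> ennreal) \<Rightarrow> bool" where
  "induces_topology d \<longleftrightarrow>
     (\<forall>S. open S \<longleftrightarrow> (\<forall>x\<in>S. \<exists>e>0. \<forall>y. d x y < e \<longrightarrow> y \<in> S))"

definition metric_hybrid_system ::
  "'a::topological_space hybrid_system \<Rightarrow> ('a \<Rightarrow> 'a \<Rightarrow> ennreal) \<Rightarrow> bool" where
  "metric_hybrid_system H d \<longleftrightarrow>
     topological_hybrid_system H \<and> extended_metric d \<and> induces_topology d"

text \<open>
  \<open>c\<close> restricted to \<open>[a, b)\<close> is a trajectory segment in the flow set; vacuous if \<open>b \<le> a\<close>.
\<close>

definition trajectory_segment ::
  "'a hybrid_system \<Rightarrow> real \<Rightarrow> ereal \<Rightarrow> (real \<Rightarrow> 'a) \<Rightarrow> bool" where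
  "trajectory_segment H a b c \<longleftrightarrow>
     (\<forall>t. a \<le> t \<and> ereal t < b \<longrightarrow>
        c t \<in> flow_set H \<and> (t - a, c a) \<in> flow_dom H \<and> c t = flow H (t - a) (c a))"

text \<open>
  \<open>arc_dom e j\<close> is the domain of the arc \<open>exec_arc e j\<close>, which a total function does not carry.
  Only the indices \<open>j \<le> num_jumps e\<close> of the arcs and \<open>j \<le> num_jumps e + 1\<close> of the
  jump times matter; all natural numbers do if the number of jumps is infinite.
\<close>

record 'a execution =
  num_jumps :: enat
  jump_time :: "nat \<Rightarrow> ereal"
  arc_dom :: "nat \<Rightarrow> real set"
  exec_arc :: "nat \<Rightarrow> real \<Rightarrow> 'a"

text \<open>
  The conditions \<open>t \<in> arc_dom e (Suc j)\<close> below, and \<open>0 \<in> arc_dom e 0\<close> in \<open>executions_from\<close>,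
  say that the initial value of the arc is defined; this is not automatic, since the last arc may
  live on an empty half-open interval.
\<close>

definition is_execution :: "'a::topological_space hybrid_system \<Rightarrow> 'a execution \<Rightarrow> bool" where
  "is_execution H e \<longleftrightarrow>
     jump_time e 0 = 0 \<and>
     (\<forall>i j. i \<le> j \<and> enat j \<le> num_jumps e + 1 \<longrightarrow> jump_time e i \<le> jump_time e j) \<and>
     (\<forall>j. enat j \<le> num_jumps e \<longrightarrow> \<bar>jump_time e j\<bar> \<noteq> \<infinity>) \<and>
     (\<forall>j. enat j \<le> num_jumps e \<longrightarrow>
        {t. jump_time e j \<le> ereal t \<and> ereal t < jump_time e (Suc j)} \<subseteq> arc_dom e j \<and>
        arc_dom e j \<subseteq> {t. jump_time e j \<le> ereal t \<and> ereal t \<le> jump_time e (Suc j)} \<and>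
        continuous_on (arc_dom e j) (exec_arc e j) \<and>
        trajectory_segment H (real_of_ereal (jump_time e j)) (jump_time e (Suc j)) (exec_arc e j)) \<and>
     (\<forall>j. enat j < num_jumps e \<longrightarrow>
        (let t = real_of_ereal (jump_time e (Suc j)) in
           arc_dom e j = {real_of_ereal (jump_time e j)..t} \<and>
           exec_arc e j t \<in> guard H \<and>
           t \<in> arc_dom e (Suc j) \<and>
           exec_arc e (Suc j) t = reset H (exec_arc e j t)))"

definition executions_from ::
  "'a::topological_space hybrid_system \<Rightarrow> 'a \<Rightarrow> 'a execution set" where
  "executions_from H x = {e. is_execution H e \<and> 0 \<in> arc_dom e 0 \<and> exec_arc e 0 0 = x}"

definition stop_time :: "'a execution \<Rightarrow> ereal" where
  "stop_time e =
     (case num_jumps e of enat n \<Rightarrow> jump_time e (n + 1) | \<infinity> \<Rightarrow> lim (jump_time e))"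

definition infinite_execution :: "'a execution \<Rightarrow> bool" where
  "infinite_execution e \<longleftrightarrow> stop_time e = \<infinity>"

definition zeno_execution :: "'a execution \<Rightarrow> bool" where
  "zeno_execution e \<longleftrightarrow> stop_time e < \<infinity> \<and> num_jumps e = \<infinity>"

definition states_at :: "'a execution \<Rightarrow> real \<Rightarrow> 'a set" where
  "states_at e t = {exec_arc e j t | j. enat j \<le> num_jumps e \<and> t \<in> arc_dom e j}"

definition states_from :: "'a execution \<Rightarrow> real \<Rightarrow> 'a set" where
  "states_from e T =
     {exec_arc e j t | j t. enat j \<le> num_jumps e \<and> t \<in> arc_dom e j \<and> real j + t \<ge> T}"

definition deterministic :: "'a hybrid_system \<Rightarrow> bool" where
  "deterministic H \<longleftrightarrow> guard H \<inter> flow_set H = {}"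

definition max_flow_time :: "'a hybrid_system \<Rightarrow> 'a \<Rightarrow> ennreal" where
  "max_flow_time H x =
     (if x \<in> flow_set H then Sup {ennreal t | t. t \<ge> 0 \<and> (t, x) \<in> flow_dom H} else 0)"

text \<open>
  The closure of the flow domain is taken in \<open>real \<times> 'a\<close>, which gives the closure in
  \<open>{0..} \<times> UNIV\<close> because that set is closed.
\<close>

definition trapping_guard :: "'a::topological_space hybrid_system \<Rightarrow> bool" where
  "trapping_guard H \<longleftrightarrow>
     (\<exists>U \<rho>. guard H \<subseteq> interior U \<and>
        continuous_on U \<rho> \<and> \<rho> ` U \<subseteq> guard H \<and> (\<forall>x\<in>guard H. \<rho> x = x) \<and>
        (\<forall>x\<in>U. max_flow_time H x < \<infinity>) \<and>
        continuous_on U (\<lambda>x. enn2real (max_flow_time H x)) \<and>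
        (let D = closure (flow_dom H) \<inter> {0..} \<times> U in
           \<exists>\<phi>'. continuous_on D \<phi>' \<and>
             (\<forall>(t, x) \<in> flow_dom H \<inter> {0..} \<times> U. \<phi>' (t, x) = flow H t x) \<and>
             (\<forall>(t, x) \<in> D. t = enn2real (max_flow_time H x) \<longrightarrow> \<phi>' (t, x) = \<rho> x) \<and>
             (\<forall>\<psi>. continuous_on D \<psi> \<and>
                (\<forall>(t, x) \<in> flow_dom H \<inter> {0..} \<times> U. \<psi> (t, x) = flow H t x) \<longrightarrow>
                (\<forall>p\<in>D. \<psi> p = \<phi>' p))))"

text \<open>
  The increasing list \<open>\<eta>\<^sub>0 < \<dots> < \<eta>\<^sub>M\<close> of indices is given by \<open>last_cont\<close>
  (the number \<open>M\<close>, possibly \<open>0\<close>) and \<open>cont_index\<close>.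
\<close>

record 'a chain =
  chain_jumps :: nat
  chain_time :: "nat \<Rightarrow> real"
  last_cont :: nat
  cont_index :: "nat \<Rightarrow> nat"
  chain_arc :: "nat \<Rightarrow> real \<Rightarrow> 'a"

definition is_chain ::
  "'a::topological_space hybrid_system \<Rightarrow> ('a \<Rightarrow> 'a \<Rightarrow> ennreal) \<Rightarrow> real \<Rightarrow> real \<Rightarrow>
     'a chain \<Rightarrow> bool" where
  "is_chain H d \<epsilon> T c \<longleftrightarrow>
     (let N = chain_jumps c; \<tau> = chain_time c; M = last_cont c; \<eta> = cont_index c;
          \<gamma> = chain_arc c
      in
        N \<ge> 1 \<and>
        \<tau> 0 = 0 \<and>
        mono_on {0..N+1} \<tau> \<and>
        \<eta> 0 = 0 \<and> strict_mono_on {0..M} \<eta> \<and> \<eta> M \<le> N \<and>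
        (\<forall>k\<in>{1..M}. \<tau> (\<eta> k) - \<tau> (\<eta> (k - 1)) \<ge> T) \<and>
        (\<forall>j\<in>{0..N}. continuous_on {\<tau> j..\<tau> (j + 1)} (\<gamma> j) \<and>
           trajectory_segment H (\<tau> j) (ereal (\<tau> (j + 1))) (\<gamma> j)) \<and>
        (\<forall>j\<in>{1..N}.
           if \<exists>k\<in>{1..M}. j = \<eta> k
           then \<gamma> (j - 1) (\<tau> j) \<in> flow_set H \<and> d (\<gamma> j (\<tau> j)) (\<gamma> (j - 1) (\<tau> j)) \<le> ennreal \<epsilon>
           else \<gamma> (j - 1) (\<tau> j) \<in> guard H \<and>
                d (\<gamma> j (\<tau> j)) (reset H (\<gamma> (j - 1) (\<tau> j))) \<le> ennreal \<epsilon>))"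

definition chain_from_to :: "'a chain \<Rightarrow> 'a \<Rightarrow> 'a \<Rightarrow> bool" where
  "chain_from_to c x y \<longleftrightarrow>
     chain_arc c 0 0 = x \<and> chain_arc c (chain_jumps c) (chain_time c (chain_jumps c + 1)) = y"

definition conley_relation ::
  "'a::topological_space hybrid_system \<Rightarrow> ('a \<Rightarrow> 'a \<Rightarrow> ennreal) \<Rightarrow> 'a \<Rightarrow> 'a \<Rightarrow> bool" where
  "conley_relation H d x y \<longleftrightarrow>
     (\<forall>\<epsilon>>0. \<forall>T>0. \<exists>c. is_chain H d \<epsilon> T c \<and> chain_from_to c x y)"

definition chain_recurrent_set ::
  "'a::topological_space hybrid_system \<Rightarrow> ('a \<Rightarrow> 'a \<Rightarrow> ennreal) \<Rightarrow> 'a set" where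
  "chain_recurrent_set H d = {x. conley_relation H d x x}"

definition chain_equivalent ::
  "'a::topological_space hybrid_system \<Rightarrow> ('a \<Rightarrow> 'a \<Rightarrow> ennreal) \<Rightarrow> 'a \<Rightarrow> 'a \<Rightarrow> bool" where
  "chain_equivalent H d x y \<longleftrightarrow> conley_relation H d x y \<and> conley_relation H d y x"

definition omega_tail :: "'a::topological_space hybrid_system \<Rightarrow> 'a set \<Rightarrow> real \<Rightarrow> 'a set" where
  "omega_tail H U T = closure (\<Union>x\<in>U. \<Union>e\<in>executions_from H x. states_from e T)"

definition omega_limit :: "'a::topological_space hybrid_system \<Rightarrow> 'a set \<Rightarrow> 'a set" where
  "omega_limit H U = (\<Inter>T\<in>{0<..}. omega_tail H U T)"

definition forward_invariant :: "'a::topological_space hybrid_system \<Rightarrow> 'a set \<Rightarrow> bool" where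
  "forward_invariant H S \<longleftrightarrow>
     (\<forall>x\<in>S. \<forall>e\<in>executions_from H x. \<forall>t\<ge>0. states_at e t \<subseteq> S)"

definition trapping_set :: "'a::topological_space hybrid_system \<Rightarrow> 'a set \<Rightarrow> bool" where
  "trapping_set H U \<longleftrightarrow>
     compact (closure U) \<and> forward_invariant H U \<and> (\<exists>T>0. omega_tail H U T \<subseteq> interior U)"

definition attracting_set :: "'a::topological_space hybrid_system \<Rightarrow> 'a set \<Rightarrow> bool" where
  "attracting_set H A \<longleftrightarrow> (\<exists>U. trapping_set H U \<and> A = omega_limit H U)"

definition dual_repelling_set ::
  "'a::topological_space hybrid_system \<Rightarrow> 'a set \<Rightarrow> 'a set" where
  "dual_repelling_set H A = {x. omega_limit H {x} \<inter> A = {}}"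

definition attracting_repelling_pair ::
  "'a::topological_space hybrid_system \<Rightarrow> 'a set \<Rightarrow> 'a set \<Rightarrow> bool" where
  "attracting_repelling_pair H A B \<longleftrightarrow> attracting_set H A \<and> B = dual_repelling_set H A"

end

theory Submission
  imports Defs
begin

text \<open>
The theorem is Conley's decomposition for hybrid systems.  Because every state has an infinite or
Zeno execution and guard and flow set are disjoint, the state space is the disjoint union of the
flow set and the guard, and motion is forced: flow until the guard is met, then reset.  Write
\<open>flows_to H t x y\<close> if flowing from \<open>x\<close> for time \<open>t\<close> without a reset ends at \<open>y\<close>, where \<open>y\<close> may be a
point of the guard.  The trapping guard condition enters at a single place: it makes this relation
closed in \<open>(t, x, y)\<close> (\<open>closed_flows_to\<close>), although the flow alone is continuous only on an open
set and says nothing about arrival at the guard.  Besides closedness, the rest of the proof uses of the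
flow only that arcs compose, that they are unique, and that the flow is continuous on an open domain.
The relation
\<open>reaches H n t x y\<close> (\<open>n\<close> resets, total flow time \<open>t\<close>) describes the states of executions, and
\<open>n + t\<close> is the time that occurs in the definition of limit sets.

Two implications carry the theorem.

If there is no \<open>(\<epsilon>, T)\<close>-chain from \<open>x\<close> to \<open>y\<close>, then some attracting set \<open>A\<close> misses \<open>y\<close> while the
limit set of \<open>x\<close> meets \<open>A\<close> (\<open>separating_attractor\<close>).  In the classical proof for maps the
points that are reachable by chains form a trapping set, since the last jump of a chain covers a
full ball.  Here a chain may end with an arc of flow, a semiflow need not be open, and jumps off the
guard must be separated by time \<open>T\<close>, so the endpoints of chains need not form a neighbourhood of the
states that they reach.  The remedy is to look at a forced step: flow for time exactly
\<open>T\<close> if the guard is at least \<open>2 * T\<close> away, and otherwise flow to the guard and reset.  Chains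
built from forced steps and \<open>\<epsilon>\<close>-jumps end in an open set \<open>N\<close> that absorbs the closure \<open>Q\<close> of its
own forced steps.  The arcs that issue from \<open>Q\<close> fill a closed set \<open>B\<close> of endpoints of
\<open>(\<epsilon>, T)\<close>-chains, and all states that flow or reset into \<open>N\<close> soon enough form an open
neighbourhood \<open>V\<close> of \<open>B\<close> whose orbits settle in \<open>B\<close> after a bounded time.  Hence the forward
orbit of \<open>V\<close> is a trapping set, and its attracting set lies in \<open>B\<close>.

Conversely, if the limit set of \<open>x\<close> meets \<open>A\<close> and \<open>x\<close>, \<open>y\<close> are joined by chains in both directions,
then \<open>y\<close> belongs to \<open>A\<close> (\<open>chain_equivalent_in_attractor\<close>).  Going back and forth gives chains
from \<open>x\<close> to \<open>y\<close> with as many jumps as desired.  Over a bounded time, chains with small errors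
end close to true orbits (\<open>pseudo_orbit_shadowing\<close>, by compactness), and true orbits that start
at \<open>x\<close> or near the tail of the trapping set are deep in that tail after a bounded time.  So long chains
from \<open>x\<close> end near the tail; a point \<open>y\<close> outside \<open>A\<close> is outside some tail.

The theorem follows because a point of \<open>A\<close> is never in the dual repelling set of \<open>A\<close>.
\<close>

section \<open>Compactness and extended metrics\<close>

text \<open>
The tube lemma in the form that is used throughout: a relation that is obtained from closed ones by
existential quantification over a compact set is closed.  It takes the place of arguments with
convergent subsequences.
\<close>

lemma closed_compact_projection_param:
  fixes R :: "('a::topological_space \<times> 'b::topological_space) set"
  assumes "closed R" "compact Q"
  shows "closed {p. \<exists>q\<in>Q. (p, q) \<in> R}"
proof -
  have "open (- {p. \<exists>q\<in>Q. (p, q) \<in> R})"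
  proof (rule Topological_Spaces.openI)
    fix p assume "p \<in> - {p. \<exists>q\<in>Q. (p, q) \<in> R}"
    then have "{p} \<times> Q \<subseteq> - R" by auto
    from Elementary_Topology.tube_lemma[OF \<open>compact Q\<close> _ this] \<open>closed R\<close>
    obtain P where "p \<in> P" "open P" "P \<times> Q \<subseteq> - R" by (auto simp: open_Compl)
    then show "\<exists>T. open T \<and> p \<in> T \<and> T \<subseteq> - {p. \<exists>q\<in>Q. (p, q) \<in> R}"
      by (intro exI[of _ P]) auto
  qed
  then show ?thesis by (simp add: closed_def)
qed

text \<open>
The source of all uniform error bounds: a closed condition on an error and a point that no
point of a compact set satisfies with error \<open>0\<close> fails for all small errors simultaneously, because the
set of errors for which it holds somewhere is closed.
\<close>

lemma compact_zero_gap: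
  fixes R :: "(real \<times> 'b::topological_space) set"
  assumes "closed R" "compact Q" "\<And>q. q \<in> Q \<Longrightarrow> (0, q) \<notin> R"
  obtains \<delta> where "\<delta> > 0" "\<And>q \<delta>'. q \<in> Q \<Longrightarrow> 0 \<le> \<delta>' \<Longrightarrow> \<delta>' \<le> \<delta> \<Longrightarrow> (\<delta>', q) \<notin> R"
proof -
  have "open (- {e. \<exists>q\<in>Q. (e, q) \<in> R})"
    using closed_compact_projection_param[OF assms(1,2)] by (simp add: open_Compl)
  moreover have "0 \<in> - {e. \<exists>q\<in>Q. (e, q) \<in> R}" using assms(3) by auto
  ultimately obtain \<delta> where "\<delta> > 0" "cball 0 \<delta> \<subseteq> - {e. \<exists>q\<in>Q. (e, q) \<in> R}"
    by (meson open_contains_cball)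
  then show ?thesis
    by (intro that[of \<delta>]) (auto simp: subset_iff dist_real_def)
qed

locale compact_emetric =
  fixes d :: "'a::topological_space \<Rightarrow> 'a \<Rightarrow> ennreal"
  assumes extended_metric: "extended_metric d"
    and induces_topology: "induces_topology d"
    and compact_UNIV: "compact (UNIV :: 'a set)"
begin

lemma dist_self [simp]: "d x x = 0"
  using extended_metric by (auto simp: extended_metric_def)

lemma dist_eq_0 [simp]: "d x y = 0 \<longleftrightarrow> x = y"
  using extended_metric by (auto simp: extended_metric_def)

lemma dist_sym: "d x y = d y x"
  using extended_metric by (auto simp: extended_metric_def)

lemma dist_triangle: "d x z \<le> d x y + d y z"
  using extended_metric by (auto simp: extended_metric_def)

lemma open_iff_ball: "open S \<longleftrightarrow> (\<forall>x\<in>S. \<exists>e>0. \<forall>y. d x y < e \<longrightarrow> y \<in> S)"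
  using induces_topology by (auto simp: induces_topology_def)

lemma open_dist_ball: "open {y. d x y < e}"
  unfolding open_iff_ball
proof (intro ballI)
  fix y assume "y \<in> {y. d x y < e}"
  then have y: "d x y < e" by simp
  show "\<exists>e'>0. \<forall>z. d y z < e' \<longrightarrow> z \<in> {y. d x y < e}"
  proof (intro exI[of _ "e - d x y"] conjI allI impI)
    show "0 < e - d x y" using y by (simp add: diff_gr0_ennreal)
    fix z assume "d y z < e - d x y"
    then have "d x y + d y z < e"
      using y by (metis add.commute ennreal_minus_eq_top less_diff_eq_ennreal less_le order_less_le_trans top_greatest)
    then show "z \<in> {y. d x y < e}" using dist_triangle[of x z y] by auto
  qed
qed

lemma closure_dist: "x \<in> closure S \<Longrightarrow> e > 0 \<Longrightarrow> \<exists>y\<in>S. d x y < e"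
  using open_Int_closure_eq_empty[OF open_dist_ball[of x e], of S] by (auto simp: disjoint_iff)

text \<open>
The distance may be infinite, so the slack between \<open>c\<close> and \<open>d x y\<close> is measured up to a finite
intermediate value.
\<close>

lemma open_dist_greater: "open {(x, y). d x y > c}"
proof (rule Topological_Spaces.openI, safe)
  fix x y assume c: "c < d x y"
  then obtain c' where c': "c < c'" "c' < d x y" using dense by blast
  obtain a b where ab: "c = ennreal a" "c' = ennreal b" "0 \<le> a" "0 \<le> b"
    using c' by (metis ennreal_cases less_top_ennreal order_less_trans top.not_eq_extremum)
  have "a < b" using c' ab by (simp add: ennreal_less_iff)
  define e where "e = ennreal ((b - a) / 2)"
  have e: "e > 0" "c + e + e = c'"
    using \<open>a < b\<close> ab by (auto simp: e_def ennreal_plus[symmetric] simp del: ennreal_plus)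
  let ?T = "{x'. d x x' < e} \<times> {y'. d y y' < e}"
  have "d x' y' > c" if "d x x' < e" "d y y' < e" for x' y'
  proof (rule ccontr)
    assume "\<not> c < d x' y'"
    have "d x y \<le> d x x' + (d x' y' + d y' y)"
      by (meson add_left_mono dist_triangle order_trans)
    also have "\<dots> \<le> e + (c + e)"
      using that \<open>\<not> c < d x' y'\<close> by (intro add_mono) (auto simp: dist_sym)
    also have "\<dots> = c'" using e(2) by (simp add: ac_simps)
    finally show False using c' by simp
  qed
  then show "\<exists>T. open T \<and> (x, y) \<in> T \<and> T \<subseteq> {(x, y). d x y > c}"
    using e by (intro exI[of _ ?T]) (auto intro!: open_Times open_dist_ball)
qed

lemma hausdorff:
  fixes x y :: 'a
  assumes "x \<noteq> y"
  obtains U V where "open U" "open V" "x \<in> U" "y \<in> V" "U \<inter> V = {}"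
proof -
  have "(x, y) \<in> {(x, y). d x y > 0}" using assms by (simp add: zero_less_iff_neq_zero)
  with open_dist_greater[of 0] obtain U V where
    "open U" "open V" "x \<in> U" "y \<in> V" "U \<times> V \<subseteq> {(x, y). d x y > 0}"
    unfolding open_prod_def by (metis mem_Sigma_iff)
  have "U \<inter> V = {}"
  proof (rule equals0I)
    fix z assume "z \<in> U \<inter> V"
    then have "(z, z) \<in> {(x, y). d x y > 0}" using \<open>U \<times> V \<subseteq> _\<close> by blast
    then show False by simp
  qed
  with \<open>open U\<close> \<open>open V\<close> \<open>x \<in> U\<close> \<open>y \<in> V\<close> show ?thesis by (rule that)
qed

lemma limit_unique:
  fixes x y :: 'a
  assumes "(f \<longlongrightarrow> x) L" "(f \<longlongrightarrow> y) L" "L \<noteq> bot"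
  shows "x = y"
proof (rule ccontr)
  assume "x \<noteq> y"
  from hausdorff[OF this]
  obtain U V where "open U" "open V" "x \<in> U" "y \<in> V" "U \<inter> V = {}" by metis
  then have "\<forall>\<^sub>F z in L. f z \<in> U" "\<forall>\<^sub>F z in L. f z \<in> V"
    using topological_tendstoD[OF assms(1)] topological_tendstoD[OF assms(2)] by blast+
  then have "\<forall>\<^sub>F z in L. False"
    by eventually_elim (use \<open>U \<inter> V = {}\<close> in auto)
  then show False using assms(3) by simp
qed

lemma closed_point: "closed {x :: 'a}"
proof -
  have "open (- {x})"
  proof (rule Topological_Spaces.openI)
    fix y assume "y \<in> - {x}"
    then have "y \<noteq> x" by simp
    from hausdorff[OF this] obtain U V where "open U" "y \<in> U" "x \<in> V" "U \<inter> V = {}" by metis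
    then show "\<exists>T. open T \<and> y \<in> T \<and> T \<subseteq> - {x}" by (intro exI[of _ U]) auto
  qed
  then show ?thesis by (simp add: closed_def)
qed

lemma compact_closed: "closed S \<Longrightarrow> compact (S :: 'a set)"
  using compact_Int_closed[OF compact_UNIV, of S] by simp

lemma closed_dist_le: "closed {(e, x, y). d x y \<le> ennreal e}"
proof -
  have "open {(e, x, y). d x y > ennreal e}"
  proof (rule Topological_Spaces.openI, safe)
    fix e x y assume "ennreal e < d x y"
    then obtain c where c: "ennreal e < c" "c < d x y" using dense by blast
    have "open {e. ennreal e < c}"
      using open_vimage[of "{..<c}" ennreal] continuous_on_ennreal[OF continuous_on_id, of UNIV]
      by (simp add: vimage_def)
    then show "\<exists>T. open T \<and> (e, x, y) \<in> T \<and> T \<subseteq> {(e, x, y). d x y > ennreal e}"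
      using c open_dist_greater[of c]
      by (intro exI[of _ "{e. ennreal e < c} \<times> {(x, y). d x y > c}"]) (auto intro!: open_Times)
  qed
  moreover have "- {(e, x, y). d x y \<le> ennreal e} = {(e, x, y). d x y > ennreal e}" by auto
  ultimately show ?thesis by (simp add: closed_def)
qed

text \<open>
Normality, from a positive gap between the compact sets \<open>C\<close> and \<open>- \<Omega>\<close>.
\<close>

lemma closed_neighbourhood:
  fixes C \<Omega> :: "'a set"
  assumes "closed C" "open \<Omega>" "C \<subseteq> \<Omega>"
  obtains D where "closed D" "C \<subseteq> interior D" "D \<subseteq> \<Omega>"
proof -
  have "compact (C \<times> (- \<Omega>))"
    using assms by (intro compact_Times compact_closed) auto
  moreover have "(0, q) \<notin> {(e, x, y). d x y \<le> ennreal e}" if "q \<in> C \<times> (- \<Omega>)" for q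
    using that assms by auto
  ultimately obtain \<delta> where \<delta>: "\<delta> > 0"
    "\<And>q \<delta>'. q \<in> C \<times> (- \<Omega>) \<Longrightarrow> 0 \<le> \<delta>' \<Longrightarrow> \<delta>' \<le> \<delta> \<Longrightarrow> (\<delta>', q) \<notin> {(e, x, y). d x y \<le> ennreal e}"
    using compact_zero_gap[OF closed_dist_le] by metis
  define D where "D = closure (\<Union>c\<in>C. {y. d c y < ennreal (\<delta> / 2)})"
  show ?thesis
  proof
    show "closed D" by (simp add: D_def)
    have "open (\<Union>c\<in>C. {y. d c y < ennreal (\<delta> / 2)})" by (auto intro: open_dist_ball)
    moreover have "C \<subseteq> (\<Union>c\<in>C. {y. d c y < ennreal (\<delta> / 2)})" using \<delta>(1) by auto
    ultimately show "C \<subseteq> interior D"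
      unfolding D_def by (meson closure_subset interior_maximal order_trans)
    show "D \<subseteq> \<Omega>"
    proof
      fix y assume "y \<in> D"
      then obtain z c where "c \<in> C" "d c z < ennreal (\<delta> / 2)" "d y z < ennreal (\<delta> / 2)"
        unfolding D_def using closure_dist[of y _ "ennreal (\<delta>/2)"] \<delta>(1) by fastforce
      moreover have "d c y \<le> d c z + d y z" using dist_triangle[of c y z] by (simp add: dist_sym)
      ultimately have "d c y \<le> ennreal (\<delta>/2) + ennreal (\<delta>/2)"
        by (meson add_mono less_imp_le order_trans)
      also have "\<dots> = ennreal \<delta>" using \<delta>(1) by (simp add: ennreal_plus[symmetric] del: ennreal_plus)
      finally show "y \<in> \<Omega>" using \<delta>(2)[of "(c, y)" \<delta>] \<delta>(1) \<open>c \<in> C\<close> by auto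
    qed
  qed
qed

end

section \<open>Arcs of the flow\<close>

text \<open>
On \<open>[0, t)\<close> an arc is a trajectory, while its endpoint is only a limit and may lie on the guard.
An arc of length \<open>0\<close> may rest at any state, also at a guard point where no flow is defined.
\<close>

definition flows_to :: "'a::topological_space hybrid_system \<Rightarrow> real \<Rightarrow> 'a \<Rightarrow> 'a \<Rightarrow> bool" where
  "flows_to H t x y \<longleftrightarrow> 0 \<le> t \<and>
     (\<exists>c. continuous_on {0..t} c \<and> trajectory_segment H 0 (ereal t) c \<and> c 0 = x \<and> c t = y)"

locale conley_hybrid_system = compact_emetric d
  for d :: "'a::topological_space \<Rightarrow> 'a \<Rightarrow> ennreal" +
  fixes H :: "'a hybrid_system"
  assumes topological: "topological_hybrid_system H"
    and deterministic: "deterministic H"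
    and maximal_execution:
      "\<forall>x. \<exists>e\<in>executions_from H x. infinite_execution e \<or> zeno_execution e"
    and trapping_guard: "trapping_guard H"
begin

abbreviation "F \<equiv> flow_set H"
abbreviation "G \<equiv> guard H"
abbreviation "D \<equiv> flow_dom H"
abbreviation "\<phi> \<equiv> flow H"
abbreviation "r \<equiv> reset H"

lemma open_flow_set: "open F"
  and closed_guard: "closed G"
  and continuous_reset: "continuous_on G r"
  and continuous_flow: "continuous_on D (\<lambda>(t, x). \<phi> t x)"
  and flow_dom_openin: "openin (top_of_set ({0..} \<times> F)) D"
  using topological by (auto simp: topological_hybrid_system_def local_semiflow_def)

lemma guard_not_flow: "x \<in> G \<Longrightarrow> x \<notin> F"
  using deterministic by (auto simp: deterministic_def)

lemma flow_domD: "(t, x) \<in> D \<Longrightarrow> 0 \<le> t" "(t, x) \<in> D \<Longrightarrow> x \<in> F"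
  using openin_imp_subset[OF flow_dom_openin] by auto

lemma flow_dom_0: "x \<in> F \<Longrightarrow> (0, x) \<in> D"
  and flow_0: "x \<in> F \<Longrightarrow> \<phi> 0 x = x"
  and flow_in: "(t, x) \<in> D \<Longrightarrow> \<phi> t x \<in> F"
  and flow_dom_add:
    "0 \<le> t \<Longrightarrow> 0 \<le> s \<Longrightarrow> (t + s, x) \<in> D \<longleftrightarrow> (s, x) \<in> D \<and> (t, \<phi> s x) \<in> D"
  and flow_add: "0 \<le> t \<Longrightarrow> 0 \<le> s \<Longrightarrow> (t + s, x) \<in> D \<Longrightarrow> \<phi> (t + s) x = \<phi> t (\<phi> s x)"
  using topological by (auto simp: topological_hybrid_system_def local_semiflow_def)

lemma flow_dom_mono: "(t, x) \<in> D \<Longrightarrow> 0 \<le> s \<Longrightarrow> s \<le> t \<Longrightarrow> (s, x) \<in> D"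
  using flow_dom_add[of "t - s" s x] by simp

lemma flow_dom_open_trace:
  obtains W where "open W" "D = ({0..} \<times> F) \<inter> W"
  using flow_dom_openin by (auto simp: openin_open)

lemma open_flow_dom_slice: "open {x. (s, x) \<in> D}"
proof -
  obtain W where W: "open W" "D = ({0..} \<times> F) \<inter> W" by (rule flow_dom_open_trace)
  have "open (Pair s -` W)"
    by (intro open_vimage W continuous_intros)
  moreover have "{x. (s, x) \<in> D} = (if s \<ge> 0 then F \<inter> Pair s -` W else {})"
    using W(2) by auto
  ultimately show ?thesis using open_flow_set by auto
qed

lemma continuous_flow_at_time: "continuous_on {x. (s, x) \<in> D} (\<phi> s)"
proof -
  have "continuous_on {x. (s, x) \<in> D} (\<lambda>x. (\<lambda>(t, x). \<phi> t x) (s, x))"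
    by (rule continuous_on_compose2[OF continuous_flow]) (auto intro!: continuous_intros)
  then show ?thesis by simp
qed

lemma flows_to_nonneg: "flows_to H t x y \<Longrightarrow> 0 \<le> t"
  by (simp add: flows_to_def)

lemma flows_to_0_iff [simp]: "flows_to H 0 x y \<longleftrightarrow> x = y"
  by (auto simp: flows_to_def trajectory_segment_def intro!: exI[of _ "\<lambda>_. y"])

lemma flows_to_segment:
  assumes "continuous_on {a..b} c" "trajectory_segment H a e c" "a \<le> b" "ereal b \<le> e"
  shows "flows_to H (b - a) (c a) (c b)"
  unfolding flows_to_def
proof (intro conjI exI[of _ "\<lambda>s. c (a + s)"])
  show "continuous_on {0..b - a} (\<lambda>s. c (a + s))"
    by (rule continuous_on_compose2[OF assms(1)]) (auto intro!: continuous_intros)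
  show "trajectory_segment H 0 (ereal (b - a)) (\<lambda>s. c (a + s))"
    unfolding trajectory_segment_def
  proof (intro allI impI)
    fix t assume t: "0 \<le> t \<and> ereal t < ereal (b - a)"
    then have "ereal (a + t) < ereal b" by simp
    then have "ereal (a + t) < e" using assms(4) by (rule order_less_le_trans)
    moreover have "a \<le> a + t" using t by simp
    ultimately show "c (a + t) \<in> flow_set H \<and> (t - 0, c (a + 0)) \<in> flow_dom H \<and>
        c (a + t) = flow H (t - 0) (c (a + 0))"
      using assms(2) unfolding trajectory_segment_def
      by (metis add.right_neutral add_diff_cancel_left' diff_zero)
  qed
qed (use assms in auto)

text \<open>
An arc of positive length is determined by its start: it follows the flow and ends at its limit
from the left.  This reduces the algebra of arcs to that of the semiflow.
\<close>

lemma flows_to_iff_limit: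
  assumes "0 < t"
  shows "flows_to H t x y \<longleftrightarrow> (\<forall>s\<in>{0..<t}. (s, x) \<in> D) \<and> ((\<lambda>s. \<phi> s x) \<longlongrightarrow> y) (at_left t)"
    (is "_ \<longleftrightarrow> ?R")
proof
  assume "flows_to H t x y"
  then obtain c where c: "continuous_on {0..t} c" "trajectory_segment H 0 (ereal t) c"
      "c 0 = x" "c t = y"
    by (auto simp: flows_to_def)
  have seg: "(s, x) \<in> D" "c s = \<phi> s x" if "s \<in> {0..<t}" for s
    using c that by (auto simp: trajectory_segment_def)
  have "(c \<longlongrightarrow> y) (at_left t)"
    using c assms by (metis at_within_Icc_at_left atLeastAtMost_iff continuous_on less_imp_le order_refl)
  moreover have "\<forall>\<^sub>F s in at_left t. c s = \<phi> s x"
    using eventually_at_left_real[OF assms] by eventually_elim (use seg in auto)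
  ultimately have "((\<lambda>s. \<phi> s x) \<longlongrightarrow> y) (at_left t)"
    by (rule Lim_transform_eventually)
  then show ?R using seg by auto
next
  assume R: ?R
  define c where "c s = (if s < t then \<phi> s x else y)" for s
  have x: "x \<in> F" using R assms flow_domD by fastforce
  have "continuous_on {0..t} c"
    unfolding continuous_on_eq_continuous_within
  proof
    fix s assume s: "s \<in> {0..t}"
    show "continuous (at s within {0..t}) c"
    proof (cases "s = t")
      case True
      have "\<forall>\<^sub>F s in at_left t. \<phi> s x = c s"
        using eventually_at_left_real[OF assms] by eventually_elim (auto simp: c_def)
      then have "(c \<longlongrightarrow> y) (at_left t)"
        using R Lim_transform_eventually by blast
      then show ?thesis using True assms
        by (simp add: continuous_within at_within_Icc_at_left c_def)
    next
      case False
      have "continuous_on {0..<t} (\<lambda>s. (\<lambda>(t, x). \<phi> t x) (s, x))"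
        by (rule continuous_on_compose2[OF continuous_flow]) (use R in \<open>auto intro!: continuous_intros\<close>)
      then have "continuous_on {0..<t} c"
        by (rule continuous_on_eq) (auto simp: c_def)
      then have "continuous (at s within {0..<t}) c"
        using s False by (auto simp: continuous_on_eq_continuous_within)
      moreover have "at s within {0..<t} = at s within {0..t}"
        by (rule at_within_nhd[of _ "{..<t}"]) (use s False in auto)
      ultimately show ?thesis by simp
    qed
  qed
  moreover have "trajectory_segment H 0 (ereal t) c"
    unfolding trajectory_segment_def c_def using R assms x flow_in flow_0 by auto
  ultimately show "flows_to H t x y"
    unfolding flows_to_def using assms x flow_0 by (intro conjI exI[of _ c]) (auto simp: c_def)
qed

lemma flows_to_flow_dom: "flows_to H t x y \<Longrightarrow> 0 \<le> s \<Longrightarrow> s < t \<Longrightarrow> (s, x) \<in> D"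
  using flows_to_iff_limit[of t x y] by auto

lemma flows_to_limit: "flows_to H t x y \<Longrightarrow> 0 < t \<Longrightarrow> ((\<lambda>s. \<phi> s x) \<longlongrightarrow> y) (at_left t)"
  using flows_to_iff_limit[of t x y] by auto

lemma flows_to_start_flow_set: "flows_to H t x y \<Longrightarrow> 0 < t \<Longrightarrow> x \<in> F"
  using flows_to_flow_dom[of t x y 0] flow_domD by auto

lemma flows_to_unique: "flows_to H t x y \<Longrightarrow> flows_to H t x z \<Longrightarrow> y = z"
proof (cases "t = 0")
  case False
  assume "flows_to H t x y" "flows_to H t x z"
  moreover from this False have "0 < t" using flows_to_nonneg by force
  ultimately show ?thesis
    using limit_unique[of "\<lambda>s. \<phi> s x" y "at_left t" z] by (simp add: flows_to_limit)
qed auto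

lemma flow_flows_to:
  assumes D: "(t, x) \<in> D"
  shows "flows_to H t x (\<phi> t x)"
  unfolding flows_to_def
proof (intro conjI exI[of _ "\<lambda>s. \<phi> s x"])
  have "continuous_on {0..t} (\<lambda>s. (\<lambda>(t, x). \<phi> t x) (s, x))"
    by (rule continuous_on_compose2[OF continuous_flow])
      (use D flow_dom_mono in \<open>auto intro!: continuous_intros\<close>)
  then show "continuous_on {0..t} (\<lambda>s. \<phi> s x)" by simp
  show "trajectory_segment H 0 (ereal t) (\<lambda>s. \<phi> s x)"
    unfolding trajectory_segment_def
  proof (intro allI impI)
    fix s assume s: "0 \<le> s \<and> ereal s < ereal t"
    then have "(s, x) \<in> D" using flow_dom_mono[OF D, of s] by simp
    then show "\<phi> s x \<in> F \<and> (s - 0, \<phi> 0 x) \<in> D \<and> \<phi> s x = \<phi> (s - 0) (\<phi> 0 x)"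
      using flow_in flow_0[of x] flow_domD(2) by simp
  qed
  show "0 \<le> t" "\<phi> 0 x = x" using flow_domD[OF D] flow_0[of x] by simp_all
qed simp

text \<open>
Near a point \<open>y\<close> of the flow set the flow lasts for some uniform time.  An arc that ends at \<open>y\<close>
therefore cannot end at the boundary of the domain.
\<close>

lemma flows_to_into_flow_set:
  assumes "flows_to H t x y" "y \<in> F"
  shows "(t, x) \<in> D" "\<phi> t x = y"
proof -
  show D: "(t, x) \<in> D"
  proof (cases "t = 0")
    case True
    then show ?thesis using assms flow_dom_0 by simp
  next
    case False
    then have t: "0 < t" using assms flows_to_nonneg by force
    obtain W where W: "open W" "D = ({0..} \<times> F) \<inter> W" by (rule flow_dom_open_trace)
    have "((\<lambda>s. (t - s, \<phi> s x)) \<longlongrightarrow> (t - t, y)) (at_left t)"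
      by (intro tendsto_intros flows_to_limit assms t)
    moreover have "(t - t, y) \<in> W" using flow_dom_0[OF assms(2)] W(2) by auto
    ultimately have "\<forall>\<^sub>F s in at_left t. (t - s, \<phi> s x) \<in> W"
      using W(1) topological_tendstoD by blast
    then have "\<forall>\<^sub>F s in at_left t. (t - s, \<phi> s x) \<in> W \<and> s \<in> {0<..<t}"
      using eventually_at_left_real[OF t] by eventually_elim auto
    then obtain s where s: "(t - s, \<phi> s x) \<in> W" "0 < s" "s < t"
      using eventually_happens'[of "at_left t"] by force
    have sD: "(s, x) \<in> D" using flows_to_flow_dom[OF assms(1)] s by auto
    then have "(t - s, \<phi> s x) \<in> D" using s W(2) flow_in by auto
    then show ?thesis using flow_dom_add[of "t - s" s x] s sD by auto
  qed
  show "\<phi> t x = y" using flows_to_unique[OF flow_flows_to[OF D] assms(1)] .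
qed

lemma tendsto_at_left_shift:
  "((\<lambda>u. f (u - s)) \<longlongrightarrow> z) (at_left (t + s)) \<longleftrightarrow> (f \<longlongrightarrow> z) (at_left (t :: real))"
proof -
  have "at_left t = filtermap (\<lambda>u. u - s) (at_left (t + s))"
    by (simp add: filtermap_at_left_shift)
  then show ?thesis by (simp add: filterlim_filtermap)
qed

lemma flows_to_shift:
  assumes "(s, x) \<in> D" "0 < t"
  shows "flows_to H (t + s) x z \<longleftrightarrow> flows_to H t (\<phi> s x) z"
proof -
  have s: "0 \<le> s" using assms flow_domD by auto
  have dom: "(\<forall>u\<in>{0..<t + s}. (u, x) \<in> D) \<longleftrightarrow> (\<forall>u\<in>{0..<t}. (u, \<phi> s x) \<in> D)"
  proof safe
    fix u assume "\<forall>u\<in>{0..<t + s}. (u, x) \<in> D" "u \<in> {0..<t}"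
    then show "(u, \<phi> s x) \<in> D" using flow_dom_add[of u s x] s by auto
  next
    fix u assume *: "\<forall>u\<in>{0..<t}. (u, \<phi> s x) \<in> D" "u \<in> {0..<t + s}"
    show "(u, x) \<in> D"
    proof (cases "u \<le> s")
      case True
      then show ?thesis using * flow_dom_mono[OF assms(1)] by auto
    next
      case False
      then show ?thesis using * assms(1) flow_dom_add[of "u - s" s x] s by auto
    qed
  qed
  have lim: "((\<lambda>u. \<phi> u x) \<longlongrightarrow> z) (at_left (t + s)) \<longleftrightarrow> ((\<lambda>u. \<phi> u (\<phi> s x)) \<longlongrightarrow> z) (at_left t)"
    if D: "\<forall>u\<in>{0..<t + s}. (u, x) \<in> D"
  proof -
    have ev: "\<forall>\<^sub>F u in at_left (t + s). \<phi> u x = \<phi> (u - s) (\<phi> s x)"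
    proof (rule eventually_mono)
      show "\<forall>\<^sub>F u in at_left (t + s). u \<in> {s<..<t + s}"
        using eventually_at_left_real[of s "t + s"] assms(2) by simp
      fix u assume "u \<in> {s<..<t + s}"
      then show "\<phi> u x = \<phi> (u - s) (\<phi> s x)"
        using flow_add[of "u - s" s x] D s by auto
    qed
    show ?thesis
      using tendsto_cong[OF ev] tendsto_at_left_shift[of "\<lambda>u. \<phi> u (\<phi> s x)" s z t] by simp
  qed
  show ?thesis
    using flows_to_iff_limit[of "t + s" x z] flows_to_iff_limit[of t "\<phi> s x" z] dom lim assms s by auto
qed

lemma flows_to_split:
  assumes "flows_to H (t + s) x z" "0 \<le> t" "0 \<le> s"
  obtains y where "flows_to H s x y" "flows_to H t y z"
proof (cases "t = 0")
  case True
  then show ?thesis using that[of z] assms by simp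
next
  case False
  then have "(s, x) \<in> D" using flows_to_flow_dom[OF assms(1)] assms by auto
  then show ?thesis using that[of "\<phi> s x"] flow_flows_to flows_to_shift[of s x t z] assms False by auto
qed

lemma flows_to_append:
  assumes "flows_to H s x y" "flows_to H t y z"
  shows "flows_to H (s + t) x z"
proof (cases "t = 0")
  case True
  then show ?thesis using assms by simp
next
  case False
  then have t: "0 < t" using assms flows_to_nonneg by force
  then have "(s, x) \<in> D" "\<phi> s x = y"
    using flows_to_into_flow_set[OF assms(1)] flows_to_start_flow_set[OF assms(2)] by auto
  then show ?thesis using flows_to_shift[of s x t z] t assms by (simp add: add.commute)
qed

lemma flows_to_remainder:
  assumes "flows_to H s x y" "flows_to H t x z" "s \<le> t"
  shows "flows_to H (t - s) y z"
proof -
  obtain y' where "flows_to H s x y'" "flows_to H (t - s) y' z"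
    using flows_to_split[of "t - s" s x z] assms flows_to_nonneg by auto
  then show ?thesis using assms flows_to_unique by metis
qed

text \<open>
Here disjointness of guard and flow set makes the motion deterministic: an arc that could be
prolonged beyond \<open>g\<close> would have \<open>g\<close> in the flow set.
\<close>

lemma guard_arrival_longest:
  assumes "flows_to H t x g" "g \<in> G" "flows_to H s x y"
  shows "s \<le> t"
proof (rule ccontr)
  assume "\<not> s \<le> t"
  then have "(t, x) \<in> D" using flows_to_flow_dom[OF assms(3)] flows_to_nonneg[OF assms(1)] by auto
  then show False
    using flows_to_unique[OF assms(1) flow_flows_to] flow_in guard_not_flow assms(2) by metis
qed

lemma guard_arrival_unique:
  assumes "flows_to H t x g" "g \<in> G" "flows_to H s x g'" "g' \<in> G"
  shows "s = t" "g' = g"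
proof -
  show "s = t" using guard_arrival_longest assms by (metis order_antisym)
  then show "g' = g" using flows_to_unique assms by metis
qed

section \<open>Executions seen as sequences of arcs\<close>

lemma execution_arc_start:
  assumes "e \<in> executions_from H x" "enat j \<le> num_jumps e"
  shows "real_of_ereal (jump_time e j) \<in> arc_dom e j"
proof (cases j)
  case 0
  then show ?thesis using assms by (simp add: executions_from_def is_execution_def)
next
  case (Suc i)
  then have "enat i < num_jumps e" using assms(2) by (simp add: Suc_ile_eq)
  then show ?thesis using assms Suc by (auto simp: executions_from_def is_execution_def Let_def)
qed

lemma execution_jump_time:
  assumes "e \<in> executions_from H x" "enat j \<le> num_jumps e"
  shows "ereal (real_of_ereal (jump_time e j)) = jump_time e j"
  using assms by (auto simp: executions_from_def is_execution_def ereal_real)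

lemma execution_arc:
  assumes e: "e \<in> executions_from H x" "enat j \<le> num_jumps e" and t: "t \<in> arc_dom e j"
  defines "a \<equiv> real_of_ereal (jump_time e j)"
  shows "flows_to H (t - a) (exec_arc e j a) (exec_arc e j t)"
proof -
  have *: "{t. jump_time e j \<le> ereal t \<and> ereal t < jump_time e (Suc j)} \<subseteq> arc_dom e j"
    "arc_dom e j \<subseteq> {t. jump_time e j \<le> ereal t \<and> ereal t \<le> jump_time e (Suc j)}"
    "continuous_on (arc_dom e j) (exec_arc e j)"
    "trajectory_segment H a (jump_time e (Suc j)) (exec_arc e j)"
    using e by (auto simp: executions_from_def is_execution_def a_def)
  have a: "ereal a = jump_time e j" using execution_jump_time[OF e] by (simp add: a_def)
  have t': "ereal a \<le> ereal t" "ereal t \<le> jump_time e (Suc j)" using *(2) t a by auto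
  have "{a..t} \<subseteq> arc_dom e j"
  proof
    fix u assume u: "u \<in> {a..t}"
    show "u \<in> arc_dom e j"
    proof (cases "u = t")
      case False
      then have "ereal u < ereal t" using u by simp
      then have "ereal u < jump_time e (Suc j)" using t'(2) by (rule order_less_le_trans)
      moreover have "jump_time e j \<le> ereal u" using u a by (metis atLeastAtMost_iff ereal_less_eq(3))
      ultimately show ?thesis using *(1) by auto
    qed (use t in simp)
  qed
  then show ?thesis
    using flows_to_segment[of a t "exec_arc e j" "jump_time e (Suc j)"] * t'
      continuous_on_subset[OF *(3)] by auto
qed

lemma execution_jump:
  assumes e: "e \<in> executions_from H x" "enat j < num_jumps e"
  defines "a \<equiv> \<lambda>j. real_of_ereal (jump_time e j)"
  shows "arc_dom e j = {a j..a (Suc j)}" "exec_arc e j (a (Suc j)) \<in> G"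
    "exec_arc e (Suc j) (a (Suc j)) = r (exec_arc e j (a (Suc j)))"
    "flows_to H (a (Suc j) - a j) (exec_arc e j (a j)) (exec_arc e j (a (Suc j)))"
proof -
  show *: "arc_dom e j = {a j..a (Suc j)}" "exec_arc e j (a (Suc j)) \<in> G"
      "exec_arc e (Suc j) (a (Suc j)) = r (exec_arc e j (a (Suc j)))"
    using e by (auto simp: executions_from_def is_execution_def Let_def a_def)
  have j: "enat j \<le> num_jumps e" using e by simp
  have "a j \<le> a (Suc j)"
    using execution_arc_start[OF e(1) j] *(1) by (auto simp: a_def)
  then show "flows_to H (a (Suc j) - a j) (exec_arc e j (a j)) (exec_arc e j (a (Suc j)))"
    using execution_arc[OF e(1) j, of "a (Suc j)"] *(1) by (auto simp: a_def)
qed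

text \<open>
The last arc of an infinite or Zeno execution lasts forever: with finitely many jumps the
execution cannot be Zeno, so its stop time, the end of the last arc, is infinite.
\<close>

lemma maximal_execution_arc:
  assumes e: "e \<in> executions_from H x" "infinite_execution e \<or> zeno_execution e"
    and j: "enat j \<le> num_jumps e"
  defines "a \<equiv> \<lambda>j. real_of_ereal (jump_time e j)"
  shows "(\<forall>t\<ge>0. a j + t \<in> arc_dom e j \<and> flows_to H t (exec_arc e j (a j)) (exec_arc e j (a j + t))) \<or>
    enat j < num_jumps e \<and> arc_dom e j = {a j..a (Suc j)} \<and> exec_arc e j (a (Suc j)) \<in> G \<and>
      exec_arc e (Suc j) (a (Suc j)) = r (exec_arc e j (a (Suc j))) \<and>
      flows_to H (a (Suc j) - a j) (exec_arc e j (a j)) (exec_arc e j (a (Suc j)))"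
proof (cases "enat j < num_jumps e")
  case True
  then show ?thesis using execution_jump[OF e(1) True] by (simp add: a_def)
next
  case False
  then have N: "num_jumps e = enat j" using j by simp
  then have "jump_time e (Suc j) = \<infinity>"
    using e(2) by (auto simp: infinite_execution_def zeno_execution_def stop_time_def)
  moreover have "{t. jump_time e j \<le> ereal t \<and> ereal t < jump_time e (Suc j)} \<subseteq> arc_dom e j"
    using e j by (auto simp: executions_from_def is_execution_def)
  moreover have "jump_time e j \<le> ereal (a j + t)" if "t \<ge> 0" for t
    using execution_jump_time[OF e(1) j] that by (metis a_def add_increasing2 ereal_less_eq(3) order_refl)
  ultimately have "a j + t \<in> arc_dom e j" if "t \<ge> 0" for t
    using that by auto
  then show ?thesis
    using execution_arc[OF e(1) j, of "a j + t" for t] by (auto simp: a_def)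
qed

text \<open>
The hypothesis on executions is used through this alternative: the flow lasts for time \<open>b\<close> or it
meets the guard earlier.
\<close>

lemma flows_to_or_guard:
  assumes "0 \<le> b"
  shows "(\<exists>y. flows_to H b x y) \<or> (\<exists>t<b. \<exists>g\<in>G. flows_to H t x g)"
proof -
  obtain e where e: "e \<in> executions_from H x" "infinite_execution e \<or> zeno_execution e"
    using maximal_execution by blast
  have [simp]: "jump_time e 0 = 0" "exec_arc e 0 0 = x"
    using e by (auto simp: executions_from_def is_execution_def)
  have "(\<forall>t\<ge>0. \<exists>y. flows_to H t x y) \<or> (\<exists>t. \<exists>g\<in>G. flows_to H t x g)"
    using maximal_execution_arc[OF e, of 0] by (auto simp: zero_enat_def[symmetric])
  then consider (flow) "\<forall>t\<ge>0. \<exists>y. flows_to H t x y" | (guard) t g where "g \<in> G" "flows_to H t x g"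
    by blast
  then show ?thesis
  proof cases
    case guard
    then show ?thesis
      using flows_to_split[of "t - b" b x g] assms flows_to_nonneg by (cases "t < b") (auto, metis)
  qed (use assms in auto)
qed

section \<open>Closedness of the arc relation\<close>

lemma flow_time_le_max: 
  assumes "flows_to H t x y"
  shows "ennreal t \<le> max_flow_time H x"
proof (cases "t = 0")
  case False
  then have t: "0 < t" using assms flows_to_nonneg by force
  have x: "x \<in> F" using flows_to_start_flow_set[OF assms t] .
  show ?thesis
  proof (rule dense_le)
    fix s assume s: "s < ennreal t"
    then obtain s' where s': "s = ennreal s'" "0 \<le> s'"
      by (metis ennreal_cases ennreal_less_top order_less_imp_triv top.not_eq_extremum)
    then have "s' < t" using s by (simp add: ennreal_less_iff)
    then have "(s', x) \<in> D" using flows_to_flow_dom[OF assms] s' by simp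
    then show "s \<le> max_flow_time H x"
      using x s' by (auto simp: max_flow_time_def intro!: Sup_upper)
  qed
qed simp

lemma max_flow_time_guard:
  assumes "flows_to H m x g" "g \<in> G"
  shows "max_flow_time H x = ennreal m"
proof (rule antisym[OF _ flow_time_le_max[OF assms(1)]])
  have "ennreal t \<le> ennreal m" if "(t, x) \<in> D" for t
    using guard_arrival_longest[OF assms flow_flows_to[OF that]] by (rule ennreal_leI)
  then show "max_flow_time H x \<le> ennreal m"
    by (auto simp: max_flow_time_def intro!: Sup_least)
qed

text \<open>
What the trapping guard condition gives.  Near the guard the flow time is continuous, so limits
of arcs that start near \<open>x\<close> are not longer than the arc from \<open>x\<close> to the guard.  The
continuous extension of the flow evaluates each arc at its end, whether that is in the flow set or on
the guard, and at the maximal time it is the retraction; hence limits of arcs of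
maximal length end at \<open>g\<close>.  Starting points on the guard carry only arcs of length \<open>0\<close>; the
extension need not be defined there, and they are treated separately.
\<close>

lemma limit_of_arcs_near_guard:
  obtains U where "G \<subseteq> U" "open U"
    "\<forall>(L :: (real \<times> 'a \<times> 'a) filter) T X Y t x y m g.
       L \<noteq> bot \<longrightarrow> (T \<longlongrightarrow> t) L \<longrightarrow> (X \<longlongrightarrow> x) L \<longrightarrow> (Y \<longlongrightarrow> y) L \<longrightarrow>
       (\<forall>\<^sub>F z in L. flows_to H (T z) (X z) (Y z)) \<longrightarrow> flows_to H m x g \<longrightarrow> g \<in> G \<longrightarrow> x \<in> U \<longrightarrow>
       t \<le> m \<and> (t = m \<longrightarrow> y = g)"
proof -
  let ?\<mu> = "\<lambda>x. enn2real (max_flow_time H x)"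
  obtain U0 \<rho> \<psi> where U0: "G \<subseteq> interior U0"
    and \<rho>: "\<And>x. x \<in> G \<Longrightarrow> \<rho> x = x"
    and fin: "\<And>x. x \<in> U0 \<Longrightarrow> max_flow_time H x < \<infinity>"
    and cont_\<mu>: "continuous_on U0 ?\<mu>"
    and cont_\<psi>: "continuous_on (closure D \<inter> {0..} \<times> U0) \<psi>"
    and flow: "\<forall>(t, x) \<in> D \<inter> {0..} \<times> U0. \<psi> (t, x) = \<phi> t x"
    and end_val: "\<forall>(t, x) \<in> closure D \<inter> {0..} \<times> U0. t = ?\<mu> x \<longrightarrow> \<psi> (t, x) = \<rho> x"
    using trapping_guard unfolding trapping_guard_def Let_def
    by - (elim exE conjE, rule that; (assumption | erule (1) bspec))
  have \<psi>_flow: "\<psi> (t, x) = \<phi> t x" if "(t, x) \<in> D" "x \<in> U0" for t x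
    using bspec[OF flow, of "(t, x)"] flow_domD(1)[of t x] that by simp
  have \<psi>_\<rho>: "\<psi> (t, x) = \<rho> x" if "(t, x) \<in> closure D" "0 \<le> t" "x \<in> U0" "t = ?\<mu> x" for t x
    using bspec[OF end_val, of "(t, x)"] that by simp
  define U where "U = interior U0"
  have UU0: "U \<subseteq> U0" by (simp add: U_def interior_subset)
  have \<psi>_arc: "(t, x) \<in> closure D \<and> \<psi> (t, x) = y"
    if arc: "flows_to H t x y" and x: "x \<in> F" "x \<in> U" for t x y
  proof (cases "t = 0")
    case True
    then show ?thesis
      using arc x flow_dom_0 flow_0 \<psi>_flow UU0 closure_subset[of D] by auto
  next
    case False
    then have t: "0 < t" using arc flows_to_nonneg by force
    have inD: "\<forall>\<^sub>F s in at_left t. (s, x) \<in> D"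
      using eventually_at_left_real[OF t]
      by eventually_elim (use flows_to_flow_dom[OF arc] in auto)
    have lim: "((\<lambda>s. (s, x)) \<longlongrightarrow> (t, x)) (at_left t)"
      by (intro tendsto_intros)
    have cl: "(t, x) \<in> closure D"
    proof (rule Lim_in_closed_set[OF closed_closure _ _ lim])
      show "\<forall>\<^sub>F s in at_left t. (s, x) \<in> closure D"
        using inD by eventually_elim (use closure_subset[of D] in auto)
    qed simp
    have "((\<lambda>s. \<psi> (s, x)) \<longlongrightarrow> \<psi> (t, x)) (at_left t)"
    proof (rule continuous_on_tendsto_compose[OF cont_\<psi> lim])
      show "(t, x) \<in> closure D \<inter> {0..} \<times> U0" using cl t x UU0 by auto
      show "\<forall>\<^sub>F s in at_left t. (s, x) \<in> closure D \<inter> {0..} \<times> U0"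
        using inD by eventually_elim (use closure_subset[of D] x UU0 flow_domD in auto)
    qed
    moreover have "\<forall>\<^sub>F s in at_left t. \<psi> (s, x) = \<phi> s x"
      using inD by eventually_elim (use x UU0 \<psi>_flow in auto)
    ultimately have "((\<lambda>s. \<phi> s x) \<longlongrightarrow> \<psi> (t, x)) (at_left t)"
      by (rule Lim_transform_eventually)
    then have "\<psi> (t, x) = y"
      using flows_to_limit[OF arc t] limit_unique[of "\<lambda>s. \<phi> s x" "\<psi> (t, x)" "at_left t" y] by simp
    then show ?thesis using cl by simp
  qed
  have key: "t \<le> m \<and> (t = m \<longrightarrow> y = g)"
    if L: "L \<noteq> bot" and T: "(T \<longlongrightarrow> t) L" and X: "(X \<longlongrightarrow> x) L" and Y: "(Y \<longlongrightarrow> y) L"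
      and arcs: "\<forall>\<^sub>F z in L. flows_to H (T z) (X z) (Y z)"
      and g: "flows_to H m x g" "g \<in> G" and x: "x \<in> U"
    for L :: "(real \<times> 'a \<times> 'a) filter" and T X Y t x y m g
  proof -
    have m: "?\<mu> x = m" using max_flow_time_guard[OF g] flows_to_nonneg[OF g(1)] by simp
    have XU: "\<forall>\<^sub>F z in L. X z \<in> U"
      using topological_tendstoD[OF X] x by (simp add: U_def)
    have "((\<lambda>z. ?\<mu> (X z)) \<longlongrightarrow> ?\<mu> x) L"
      by (rule continuous_on_tendsto_compose[OF cont_\<mu> X])
        (use XU x UU0 in \<open>auto elim!: eventually_mono\<close>)
    moreover have "\<forall>\<^sub>F z in L. T z \<le> ?\<mu> (X z)"
      using XU arcs
    proof eventually_elim
      fix z assume z: "X z \<in> U" "flows_to H (T z) (X z) (Y z)"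
      then have "max_flow_time H (X z) < top" using fin UU0 by auto
      then show "T z \<le> ?\<mu> (X z)"
        using enn2real_mono[OF flow_time_le_max[OF z(2)]] flows_to_nonneg[OF z(2)] by simp
    qed
    ultimately have tm: "t \<le> m" using tendsto_le[OF L _ T] m by auto
    have t0: "0 \<le> t"
      by (rule tendsto_lowerbound[OF T _ L]) (use arcs flows_to_nonneg in \<open>auto elim!: eventually_mono\<close>)
    moreover have "y = g" if "t = m"
    proof (cases "\<forall>\<^sub>F z in L. X z \<notin> F")
      case True
      have "\<forall>\<^sub>F z in L. T z = 0 \<and> X z = Y z"
        using True arcs
      proof eventually_elim
        fix z assume z: "X z \<notin> F" "flows_to H (T z) (X z) (Y z)"
        then have "T z = 0" using flows_to_start_flow_set flows_to_nonneg by (metis less_eq_real_def)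
        then show "T z = 0 \<and> X z = Y z" using z by simp
      qed
      then have ev: "\<forall>\<^sub>F z in L. T z = 0" "\<forall>\<^sub>F z in L. X z = Y z"
        by (auto elim!: eventually_mono)
      have "t = 0" using tendsto_unique[OF L T] tendsto_eventually[OF ev(1)] by auto
      moreover have "x = y" using limit_unique[OF Lim_transform_eventually[OF X ev(2)] Y L] .
      ultimately show ?thesis using g \<open>t = m\<close> by simp
    next
      case False
      \<comment> \<open>Starting points in the flow set persist in the limit, and there the extension is available.\<close>
      define L' where "L' = inf L (principal {z. X z \<in> F})"
      have L': "L' \<noteq> bot"
        using False by (auto simp: L'_def trivial_limit_def eventually_inf_principal)
      have "L' \<le> L" by (simp add: L'_def)
      then have lims: "(T \<longlongrightarrow> t) L'" "(X \<longlongrightarrow> x) L'" "(Y \<longlongrightarrow> y) L'"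
        using T X Y by (auto intro: tendsto_mono)
      have "\<forall>\<^sub>F z in L'. X z \<in> U \<and> flows_to H (T z) (X z) (Y z)"
        using eventually_conj[OF XU arcs] \<open>L' \<le> L\<close> by (simp add: filter_leD)
      moreover have "\<forall>\<^sub>F z in L'. X z \<in> F" by (simp add: L'_def eventually_inf_principal)
      ultimately have ev: "\<forall>\<^sub>F z in L'. (T z, X z) \<in> closure D \<and> \<psi> (T z, X z) = Y z \<and>
          0 \<le> T z \<and> X z \<in> U"
        by eventually_elim (use \<psi>_arc flows_to_nonneg in auto)
      have lim: "((\<lambda>z. (T z, X z)) \<longlongrightarrow> (t, x)) L'" by (intro tendsto_intros lims)
      have cl: "(t, x) \<in> closure D"
        by (rule Lim_in_closed_set[OF closed_closure _ L' lim])
          (use ev in \<open>auto elim!: eventually_mono\<close>)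
      have "((\<lambda>z. \<psi> (T z, X z)) \<longlongrightarrow> \<psi> (t, x)) L'"
      proof (rule continuous_on_tendsto_compose[OF cont_\<psi> lim])
        show "(t, x) \<in> closure D \<inter> {0..} \<times> U0" using cl t0 x UU0 by auto
        show "\<forall>\<^sub>F z in L'. (T z, X z) \<in> closure D \<inter> {0..} \<times> U0"
          using ev by eventually_elim (use UU0 in auto)
      qed
      moreover have "\<forall>\<^sub>F z in L'. \<psi> (T z, X z) = Y z" using ev by eventually_elim simp
      ultimately have "(Y \<longlongrightarrow> \<psi> (t, x)) L'" by (rule Lim_transform_eventually)
      then have y: "y = \<psi> (t, x)" using limit_unique[OF lims(3) _ L'] by simp
      also have "\<dots> = \<rho> x" using \<psi>_\<rho>[OF cl t0] x UU0 m that by auto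
      also have "\<dots> = g"
      proof (cases "x \<in> F")
        case True
        then show ?thesis
          using \<psi>_arc[OF g(1) True x] \<psi>_\<rho>[OF cl t0] x UU0 m that by auto
      next
        case False
        then have "m = 0" using g flows_to_start_flow_set flows_to_nonneg by (metis less_eq_real_def)
        then show ?thesis using g \<rho> by simp
      qed
      finally show ?thesis .
    qed
    ultimately show ?thesis using tm by simp
  qed
  show ?thesis
    by (rule that[of U]) (use key U0 in \<open>auto simp: U_def\<close>)
qed

text \<open>
The limit of a family of arcs is found in three regimes.  Before the arc from \<open>x\<close> meets the guard,
the flow is continuous on an open domain.  If \<open>x\<close> is on the guard, the previous lemma applies.
Otherwise the arc from \<open>x\<close> is followed to a time \<open>s\<close> just before it meets the guard, where it is near
the guard, and the previous lemma is applied to the remainders of the arcs.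
\<close>

lemma closed_flows_to: "closed {(t, x, y). flows_to H t x y}"
proof -
  obtain U where U: "G \<subseteq> U" "open U"
    "\<forall>(L :: (real \<times> 'a \<times> 'a) filter) T X Y t x y m g.
       L \<noteq> bot \<longrightarrow> (T \<longlongrightarrow> t) L \<longrightarrow> (X \<longlongrightarrow> x) L \<longrightarrow> (Y \<longlongrightarrow> y) L \<longrightarrow>
       (\<forall>\<^sub>F z in L. flows_to H (T z) (X z) (Y z)) \<longrightarrow> flows_to H m x g \<longrightarrow> g \<in> G \<longrightarrow> x \<in> U \<longrightarrow>
       t \<le> m \<and> (t = m \<longrightarrow> y = g)"
    by (rule limit_of_arcs_near_guard)
  let ?K = "{(t, x, y). flows_to H t x y}"
  have "(t, x, y) \<in> ?K" if cl: "(t, x, y) \<in> closure ?K" for t x y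
  proof -
    define L where "L = inf (nhds (t, x, y)) (principal ?K)"
    let ?T = "fst :: real \<times> 'a \<times> 'a \<Rightarrow> real"
    let ?X = "\<lambda>z :: real \<times> 'a \<times> 'a. fst (snd z)"
    let ?Y = "\<lambda>z :: real \<times> 'a \<times> 'a. snd (snd z)"
    have L: "L \<noteq> bot"
    proof
      assume "L = bot"
      then have "eventually (\<lambda>z. z \<notin> ?K) (nhds (t, x, y))"
        by (simp add: L_def trivial_limit_def eventually_inf_principal)
      then obtain S where "open S" "(t, x, y) \<in> S" "S \<inter> ?K = {}"
        unfolding eventually_nhds by blast
      then show False using cl open_Int_closure_eq_empty[of S ?K] by blast
    qed
    have lim: "((\<lambda>z. z) \<longlongrightarrow> (t, x, y)) L"
      by (simp add: L_def filterlim_def)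
    have T: "(?T \<longlongrightarrow> t) L" and X: "(?X \<longlongrightarrow> x) L" and Y: "(?Y \<longlongrightarrow> y) L"
      using tendsto_fst[OF lim] tendsto_fst[OF tendsto_snd[OF lim]] tendsto_snd[OF tendsto_snd[OF lim]]
      by simp_all
    have arcs: "\<forall>\<^sub>F z in L. flows_to H (?T z) (?X z) (?Y z)"
      by (simp add: L_def eventually_inf_principal case_prod_beta)
    have t0: "0 \<le> t"
      by (rule tendsto_lowerbound[OF T _ L])
        (use arcs in \<open>auto elim!: eventually_mono dest: flows_to_nonneg\<close>)
    obtain W where W: "open W" "D = ({0..} \<times> F) \<inter> W" by (rule flow_dom_open_trace)
    \<comment> \<open>At a time at which the flow from \<open>x\<close> is defined, so is the flow from nearby states.\<close>
    have dom_ev: "\<forall>\<^sub>F z in L. (s, ?X z) \<in> D" if "(s, x) \<in> D" for s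
      using topological_tendstoD[OF X open_flow_dom_slice[of s]] that by simp
    have flow_lim: "((\<lambda>z. \<phi> s (?X z)) \<longlongrightarrow> \<phi> s x) L" if "(s, x) \<in> D" for s
      by (rule continuous_on_tendsto_compose[OF continuous_flow_at_time[of s] X])
        (use that dom_ev in auto)
    show ?thesis
    proof (cases "(t, x) \<in> D")
      case True
      have "((\<lambda>z. (?T z, ?X z)) \<longlongrightarrow> (t, x)) L" by (intro tendsto_intros T X)
      then have lim': "((\<lambda>z. (?T z, ?X z)) \<longlongrightarrow> (t, x)) L" .
      have ev: "\<forall>\<^sub>F z in L. (?T z, ?X z) \<in> D"
      proof -
        have "\<forall>\<^sub>F z in L. (?T z, ?X z) \<in> W"
          using topological_tendstoD[OF lim' W(1)] True W(2) by auto
        moreover have "\<forall>\<^sub>F z in L. ?X z \<in> F"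
          using topological_tendstoD[OF X open_flow_set] True flow_domD by auto
        ultimately show ?thesis using arcs
          by eventually_elim (use W(2) flows_to_nonneg in auto)
      qed
      have "((\<lambda>z. (\<lambda>(t, x). \<phi> t x) (?T z, ?X z)) \<longlongrightarrow> (\<lambda>(t, x). \<phi> t x) (t, x)) L"
        by (rule continuous_on_tendsto_compose[OF continuous_flow lim' True ev])
      then have "((\<lambda>z. \<phi> (?T z) (?X z)) \<longlongrightarrow> \<phi> t x) L" by simp
      moreover have "\<forall>\<^sub>F z in L. \<phi> (?T z) (?X z) = ?Y z"
        using ev arcs by eventually_elim (metis flow_flows_to flows_to_unique)
      ultimately have "(?Y \<longlongrightarrow> \<phi> t x) L" by (rule Lim_transform_eventually)
      then have "y = \<phi> t x" using limit_unique[OF Y _ L] by simp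
      then show ?thesis using flow_flows_to[OF True] by simp
    next
      case False
      have "\<not> flows_to H (t + 1) x z" for z
        using flows_to_flow_dom[of "t + 1" x z t] False t0 by auto
      then obtain m g where g: "flows_to H m x g" "g \<in> G"
        using flows_to_or_guard[of "t + 1" x] t0 by auto
      have mt: "m \<le> t" using flows_to_flow_dom[OF g(1) t0] False by force
      have "t \<le> m \<and> (t = m \<longrightarrow> y = g)"
      proof (cases "m = 0")
        case True
        then show ?thesis using U(3)[rule_format, OF L T X Y arcs g] g U(1) by auto
      next
        case False
        then have m: "0 < m" using g flows_to_nonneg by force
        have "\<forall>\<^sub>F s in at_left m. \<phi> s x \<in> U"
          using topological_tendstoD[OF flows_to_limit[OF g(1) m] U(2)] g U(1) by auto
        then have "\<forall>\<^sub>F s in at_left m. \<phi> s x \<in> U \<and> s \<in> {0<..<m}"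
          using eventually_at_left_real[OF m] by eventually_elim auto
        then obtain s where s: "\<phi> s x \<in> U" "0 < s" "s < m"
          using eventually_happens'[of "at_left m"] by force
        have sD: "(s, x) \<in> D" using flows_to_flow_dom[OF g(1)] s by auto
        have g': "flows_to H (m - s) (\<phi> s x) g"
          using flows_to_remainder[OF flow_flows_to[OF sD] g(1)] s by simp
        have T': "((\<lambda>z. ?T z - s) \<longlongrightarrow> t - s) L" by (intro tendsto_intros T)
        have "\<forall>\<^sub>F z in L. s < ?T z" using order_tendstoD(1)[OF T, of s] s mt by simp
        with arcs dom_ev[OF sD] have "\<forall>\<^sub>F z in L. flows_to H (?T z - s) (\<phi> s (?X z)) (?Y z)"
          by eventually_elim (metis flows_to_remainder flow_flows_to less_imp_le)
        from U(3)[rule_format, OF L T' flow_lim[OF sD] Y this g' g(2) s(1)] show ?thesis by simp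
      qed
      then show ?thesis using mt g by auto
    qed
  qed
  then have "closure ?K \<subseteq> ?K" by auto
  then show ?thesis using closure_subset_eq by blast
qed

end

section \<open>Orbits and limit sets\<close>

text \<open>
\<open>n\<close> counts the resets and \<open>t\<close> is the total flow time.
\<close>

primrec reaches :: "'a::topological_space hybrid_system \<Rightarrow> nat \<Rightarrow> real \<Rightarrow> 'a \<Rightarrow> 'a \<Rightarrow> bool" where
  "reaches H 0 t x y \<longleftrightarrow> flows_to H t x y"
| "reaches H (Suc n) t x y \<longleftrightarrow>
     (\<exists>s. \<exists>g\<in>guard H. flows_to H s x g \<and> reaches H n (t - s) (reset H g) y)"

context conley_hybrid_system
begin

lemma reaches_nonneg: "reaches H n t x y \<Longrightarrow> 0 \<le> t"
proof (induction n arbitrary: t x)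
  case (Suc n)
  then show ?case using flows_to_nonneg by force
qed (simp add: flows_to_nonneg)

lemma reaches_append_flow:
  "reaches H n t x y \<Longrightarrow> flows_to H s y z \<Longrightarrow> reaches H n (t + s) x z"
proof (induction n arbitrary: t x)
  case 0
  then show ?case using flows_to_append by auto
next
  case (Suc n)
  then obtain u g where u: "g \<in> G" "flows_to H u x g" "reaches H n (t - u) (r g) y" by auto
  have "reaches H n (t - u + s) (r g) z" using Suc.IH[OF u(3) Suc.prems(2)] .
  then have "reaches H n (t + s - u) (r g) z" by (simp add: algebra_simps)
  then show ?case using u by auto
qed

lemma reaches_append_reset:
  "reaches H n t x g \<Longrightarrow> g \<in> G \<Longrightarrow> reaches H (Suc n) t x (r g)"
proof (induction n arbitrary: t x)
  case (Suc n)
  then obtain u g' where u: "g' \<in> G" "flows_to H u x g'" "reaches H n (t - u) (r g') g" by auto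
  then show ?case using Suc.IH[OF u(3) Suc.prems(2)] by auto
qed (auto intro!: exI bexI)

lemma reaches_prepend_flow:
  assumes "flows_to H s x y" "reaches H n t y z"
  shows "reaches H n (s + t) x z"
proof (cases n)
  case 0
  then show ?thesis using assms flows_to_append by auto
next
  case (Suc m)
  then obtain u g where u: "g \<in> G" "flows_to H u y g" "reaches H m (t - u) (r g) z"
    using assms by auto
  then have "flows_to H (s + u) x g" using assms flows_to_append by auto
  then show ?thesis using u Suc by (auto intro!: exI[of _ "s + u"] bexI[of _ g])
qed

lemma reaches_trans:
  "reaches H n t x y \<Longrightarrow> reaches H m s y z \<Longrightarrow> reaches H (n + m) (t + s) x z"
proof (induction n arbitrary: t x)
  case 0
  then show ?case using reaches_prepend_flow by auto
next
  case (Suc n)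
  then obtain u g where u: "g \<in> G" "flows_to H u x g" "reaches H n (t - u) (r g) y" by auto
  have "reaches H (n + m) (t - u + s) (r g) z" using Suc.IH[OF u(3) Suc.prems(2)] .
  then have "reaches H (n + m) (t + s - u) (r g) z" by (simp add: algebra_simps)
  then show ?case using u by auto
qed

text \<open>
Determinism of orbits: two states on the orbit of \<open>x\<close> are ordered by their value of \<open>n + t\<close>.
\<close>

lemma reaches_remainder:
  "reaches H n t x y \<Longrightarrow> reaches H m s x z \<Longrightarrow> real n + t \<le> real m + s \<Longrightarrow>
    n \<le> m \<and> reaches H (m - n) (s - t) y z"
proof (induction n arbitrary: t x m s)
  case 0
  show ?case
  proof (cases m)
    case 0
    then show ?thesis using \<open>reaches H 0 t x y\<close> "0.prems" flows_to_remainder by auto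
  next
    case (Suc k)
    then obtain u g where u: "g \<in> G" "flows_to H u x g" "reaches H k (s - u) (r g) z"
      using "0.prems" by auto
    then have "flows_to H (u - t) y g"
      using "0.prems" flows_to_remainder guard_arrival_longest by simp
    then show ?thesis using u Suc by (auto intro!: exI[of _ "u - t"] bexI[of _ g])
  qed
next
  case (Suc n)
  then obtain u g where u: "g \<in> G" "flows_to H u x g" "reaches H n (t - u) (r g) y" by auto
  have ut: "u \<le> t" using reaches_nonneg[OF u(3)] by simp
  show ?case
  proof (cases m)
    case 0
    then have "s \<le> u" using guard_arrival_longest[OF u(2,1)] Suc.prems by simp
    then show ?thesis using Suc.prems ut 0 by simp
  next
    case (Suc k)
    then obtain u' g' where u': "g' \<in> G" "flows_to H u' x g'" "reaches H k (s - u') (r g') z"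
      using Suc.prems by auto
    then have "u' = u" "g' = g" using guard_arrival_unique[OF u(2,1) u'(2,1)] by auto
    then have k: "reaches H k (s - u) (r g) z" using u' by simp
    have "real n + (t - u) \<le> real k + (s - u)" using Suc.prems(3) Suc by simp
    from Suc.IH[OF u(3) k this] show ?thesis using Suc by simp
  qed
qed

text \<open>
Every unit of flow and every reset advances the orbit by at least one.
\<close>

lemma reaches_late: "\<exists>n t y. reaches H n t x y \<and> real k \<le> real n + t"
proof (induction k)
  case 0
  have "reaches H 0 0 x x" by simp
  then show ?case by fastforce
next
  case (Suc k)
  then obtain n t y where y: "reaches H n t x y" "real k \<le> real n + t" by auto
  consider z where "flows_to H 1 y z" | s g where "g \<in> G" "flows_to H s y g"
    using flows_to_or_guard[of 1 y] by auto
  then show ?case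
  proof cases
    case 1
    then have "reaches H n (t + 1) x z" using reaches_append_flow[OF y(1)] by simp
    then show ?thesis using y(2) by (intro exI conjI) auto
  next
    case 2
    then have "reaches H (Suc n) (t + s) x (r g)"
      using reaches_append_reset[OF reaches_append_flow[OF y(1)]] by simp
    moreover have "real (Suc k) \<le> real (Suc n) + (t + s)" using y(2) flows_to_nonneg[OF 2(2)] by simp
    ultimately show ?thesis by blast
  qed
qed

lemma execution_reaches_start:
  assumes e: "e \<in> executions_from H x"
  shows "enat j \<le> num_jumps e \<Longrightarrow>
    reaches H j (real_of_ereal (jump_time e j)) x (exec_arc e j (real_of_ereal (jump_time e j)))"
proof (induction j)
  case 0
  then show ?case using e by (simp add: executions_from_def is_execution_def)
next
  case (Suc j)
  let ?a = "\<lambda>j. real_of_ereal (jump_time e j)"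
  have j: "enat j < num_jumps e" using Suc.prems by (simp add: Suc_ile_eq)
  have "reaches H j (?a j + (?a (Suc j) - ?a j)) x (exec_arc e j (?a (Suc j)))"
    using Suc.IH j execution_jump[OF e j] by (intro reaches_append_flow) auto
  then show ?case
    using reaches_append_reset[OF _ execution_jump(2)[OF e j]] execution_jump(3)[OF e j] by simp
qed

lemma execution_reaches:
  assumes "e \<in> executions_from H x" "enat j \<le> num_jumps e" "t \<in> arc_dom e j"
  shows "reaches H j t x (exec_arc e j t)"
  using reaches_append_flow[OF execution_reaches_start[OF assms(1,2)] execution_arc[OF assms]] by simp

text \<open>
By determinism every state that can be reached is already on the given maximal execution, so
no execution ever has to be constructed.
\<close>

lemma maximal_execution_visits:
  assumes e: "e \<in> executions_from H x" "infinite_execution e \<or> zeno_execution e"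
  defines "a \<equiv> \<lambda>j. real_of_ereal (jump_time e j)"
  shows "reaches H n t p y \<Longrightarrow> enat j \<le> num_jumps e \<Longrightarrow> exec_arc e j (a j) = p \<Longrightarrow>
    enat (j + n) \<le> num_jumps e \<and> a j + t \<in> arc_dom e (j + n) \<and> exec_arc e (j + n) (a j + t) = y"
proof (induction n arbitrary: j t p)
  case 0
  have "a j + t \<in> arc_dom e j"
    using maximal_execution_arc[OF e "0.prems"(2)]
  proof
    assume "\<forall>t\<ge>0. real_of_ereal (jump_time e j) + t \<in> arc_dom e j \<and>
      flows_to H t (exec_arc e j (real_of_ereal (jump_time e j)))
        (exec_arc e j (real_of_ereal (jump_time e j) + t))"
    then show ?thesis using 0 flows_to_nonneg by (auto simp: a_def)
  next
    assume *: "enat j < num_jumps e \<and>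
      arc_dom e j = {real_of_ereal (jump_time e j)..real_of_ereal (jump_time e (Suc j))} \<and>
      exec_arc e j (real_of_ereal (jump_time e (Suc j))) \<in> G \<and>
      exec_arc e (Suc j) (real_of_ereal (jump_time e (Suc j))) =
        r (exec_arc e j (real_of_ereal (jump_time e (Suc j)))) \<and>
      flows_to H (real_of_ereal (jump_time e (Suc j)) - real_of_ereal (jump_time e j))
       (exec_arc e j (real_of_ereal (jump_time e j)))
       (exec_arc e j (real_of_ereal (jump_time e (Suc j))))"
    then have "t \<le> a (Suc j) - a j"
      using guard_arrival_longest[of "a (Suc j) - a j" p _ t y] 0 by (auto simp: a_def)
    then show ?thesis using * 0 flows_to_nonneg by (auto simp: a_def)
  qed
  then show ?case
    using execution_arc[OF e(1) "0.prems"(2), of "a j + t"] 0 flows_to_unique by (auto simp: a_def)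
next
  case (Suc n)
  then obtain s g where g: "g \<in> G" "flows_to H s p g" "reaches H n (t - s) (r g) y" by auto
  have "\<not> flows_to H (s + 1) p z" for z
    using guard_arrival_longest[OF g(2,1), of "s + 1" z] by auto
  moreover have "0 \<le> s + 1" using flows_to_nonneg[OF g(2)] by simp
  ultimately have *: "enat j < num_jumps e" "exec_arc e j (a (Suc j)) \<in> G"
      "exec_arc e (Suc j) (a (Suc j)) = r (exec_arc e j (a (Suc j)))"
      "flows_to H (a (Suc j) - a j) p (exec_arc e j (a (Suc j)))"
    using maximal_execution_arc[OF e Suc.prems(2)] Suc.prems(3) unfolding a_def by blast+
  have s: "a (Suc j) - a j = s" "exec_arc e j (a (Suc j)) = g"
    using guard_arrival_unique[OF g(2,1) *(4,2)] by auto
  have "enat (Suc j) \<le> num_jumps e" using *(1) by (simp add: Suc_ile_eq)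
  from Suc.IH[OF g(3) this] show ?case using * s by (auto simp: algebra_simps)
qed

lemma states_from_executions:
  "(\<Union>e\<in>executions_from H x. states_from e S) = {y. \<exists>n t. reaches H n t x y \<and> S \<le> real n + t}"
    (is "?L = ?R")
proof
  show "?L \<subseteq> ?R"
    unfolding states_from_def using execution_reaches by blast
  show "?R \<subseteq> ?L"
  proof
    fix y assume "y \<in> ?R"
    then obtain n t where y: "reaches H n t x y" "S \<le> real n + t" by auto
    obtain e where e: "e \<in> executions_from H x" "infinite_execution e \<or> zeno_execution e"
      using maximal_execution by blast
    have "jump_time e 0 = 0" "exec_arc e 0 0 = x"
      using e by (auto simp: executions_from_def is_execution_def)
    then have "enat n \<le> num_jumps e" "t \<in> arc_dom e n" "exec_arc e n t = y"
      using maximal_execution_visits[OF e y(1), of 0] by (auto simp: zero_enat_def[symmetric])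
    then have "y \<in> states_from e S" unfolding states_from_def using y(2) by blast
    then show "y \<in> ?L" using e(1) by blast
  qed
qed

lemma omega_tail_reaches:
  "omega_tail H U S = closure {y. \<exists>x\<in>U. \<exists>n t. reaches H n t x y \<and> S \<le> real n + t}"
  unfolding omega_tail_def states_from_executions by (rule arg_cong[of _ _ closure]) blast

lemma forward_invariant_reaches:
  "forward_invariant H U \<longleftrightarrow> (\<forall>x\<in>U. \<forall>n t y. reaches H n t x y \<longrightarrow> y \<in> U)"
proof
  assume U: "forward_invariant H U"
  show "\<forall>x\<in>U. \<forall>n t y. reaches H n t x y \<longrightarrow> y \<in> U"
  proof (intro ballI allI impI)
    fix x n t y assume x: "x \<in> U" and y: "reaches H n t x y"
    have "y \<in> {y. \<exists>n t. reaches H n t x y \<and> 0 \<le> real n + t}"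
      using y reaches_nonneg[OF y] by (auto intro!: exI[of _ n] exI[of _ t])
    then obtain e where e: "e \<in> executions_from H x" "y \<in> states_from e 0"
      unfolding states_from_executions[symmetric] by auto
    then obtain j t where j: "enat j \<le> num_jumps e" "t \<in> arc_dom e j" "y = exec_arc e j t"
      by (auto simp: states_from_def)
    then have "0 \<le> t" using execution_reaches[OF e(1)] reaches_nonneg by blast
    then have "states_at e t \<subseteq> U" using U x e by (auto simp: forward_invariant_def)
    then show "y \<in> U" using j by (auto simp: states_at_def)
  qed
next
  assume "\<forall>x\<in>U. \<forall>n t y. reaches H n t x y \<longrightarrow> y \<in> U"
  then show "forward_invariant H U"
    unfolding forward_invariant_def states_at_def using execution_reaches by blast
qed

lemma omega_limit_reaches_mono:
  assumes "reaches H n t x p" "p \<in> U"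
  shows "omega_limit H {x} \<subseteq> omega_limit H U"
proof -
  have tail: "omega_tail H {x} (S + real n + t) \<subseteq> omega_tail H U S" if "0 < S" for S
    unfolding omega_tail_reaches
  proof (intro closure_mono, safe)
    fix y m s assume y: "reaches H m s x y" "S + real n + t \<le> real m + s"
    then show "\<exists>x\<in>U. \<exists>n t. reaches H n t x y \<and> S \<le> real n + t"
      using reaches_remainder[OF assms(1) y(1)] assms(2) that
      by (intro bexI[of _ p] exI[of _ "m - n"] exI[of _ "s - t"]) auto
  qed
  have "0 < S + real n + t" if "0 < S" for S
    using that reaches_nonneg[OF assms(1)] by simp
  then show ?thesis
    unfolding omega_limit_def using tail by (auto simp: subset_iff)
qed

text \<open>
Nested nonempty closed sets in a compact space.
\<close>

lemma omega_limit_nonempty: "omega_limit H {x} \<noteq> {}"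
proof -
  have tail: "omega_tail H {x} S \<noteq> {}" for S
  proof -
    obtain n t y where "reaches H n t x y" "real (nat \<lceil>S\<rceil>) \<le> real n + t" using reaches_late by blast
    then have "reaches H n t x y \<and> S \<le> real n + t" by linarith
    then show ?thesis unfolding omega_tail_reaches by auto
  qed
  have "UNIV \<inter> (\<Inter>S\<in>{0<..}. omega_tail H {x} S) \<noteq> {}"
  proof (rule compact_imp_fip_image[OF compact_UNIV])
    fix I :: "real set" assume I: "finite I" "I \<subseteq> {0<..}"
    have "omega_tail H {x} (Max (insert 0 I)) \<subseteq> omega_tail H {x} S" if "S \<in> I" for S
      unfolding omega_tail_reaches using Max_ge[of "insert 0 I" S] I that
      by (intro closure_mono) force
    then show "UNIV \<inter> (\<Inter>S\<in>I. omega_tail H {x} S) \<noteq> {}"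
      using tail[of "Max (insert 0 I)"] by blast
  qed (simp add: omega_tail_def)
  then show ?thesis by (simp add: omega_limit_def)
qed

lemma closed_flows_to_preimage:
  assumes "continuous_on UNIV f" "continuous_on UNIV g" "continuous_on UNIV h"
  shows "closed {p. flows_to H (f p) (g p) (h p)}"
  using closed_vimage[OF closed_flows_to, of "\<lambda>p. (f p, g p, h p)"] assms
  by (simp add: vimage_def continuous_on_Pair)

lemma closed_guard_reset: "closed C \<Longrightarrow> closed {g \<in> G. r g \<in> C}"
  using continuous_closed_preimage[OF continuous_reset closed_guard] by (simp add: vimage_def Int_def)

lemma open_flows_into:
  assumes "open V"
  shows "open {x. \<exists>s\<in>{0..b}. \<exists>y\<in>V \<inter> F. flows_to H s x y}"
proof -
  have "open {x. (s, x) \<in> D \<and> \<phi> s x \<in> V}" for s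
    using continuous_open_preimage[OF continuous_flow_at_time open_flow_dom_slice assms, of s]
    by (simp add: vimage_def Int_def)
  then have "open (\<Union>s\<in>{0..b}. {x. (s, x) \<in> D \<and> \<phi> s x \<in> V})" by blast
  moreover have "(s, x) \<in> D \<and> \<phi> s x \<in> V \<longleftrightarrow> (\<exists>y\<in>V \<inter> F. flows_to H s x y)" for s x
    using flow_flows_to[of s x] flow_in[of s x] flows_to_into_flow_set[of s x] by auto
  then have "(\<Union>s\<in>{0..b}. {x. (s, x) \<in> D \<and> \<phi> s x \<in> V}) =
      {x. \<exists>s\<in>{0..b}. \<exists>y\<in>V \<inter> F. flows_to H s x y}"
    by auto
  ultimately show ?thesis by simp
qed

lemma closed_flow_image:
  assumes "closed Q"
  shows "closed {y. \<exists>q\<in>Q. \<exists>s\<in>{0..b}. flows_to H s q y}"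
proof -
  have "closed {p. flows_to H (fst (snd p)) (snd (snd p)) (fst p)}"
    by (intro closed_flows_to_preimage continuous_intros)
  from closed_compact_projection_param[OF this, of "{0..b} \<times> Q"] assms
  have "closed {y. \<exists>q\<in>{0..b} \<times> Q. flows_to H (fst q) (snd q) y}"
    by (simp add: compact_Times compact_closed)
  then show ?thesis by (rule back_subst[of closed]) auto
qed

text \<open>
By \<open>flows_to_or_guard\<close> a state fails to be in this set exactly if its flow lasts for time \<open>b\<close> or
if it meets the guard by time \<open>b\<close> in a point that is not reset into \<open>V\<close>; by compactness both
conditions are closed.
\<close>

lemma open_resets_into:
  assumes "open V" "0 \<le> b"
  shows "open {x. \<exists>t<b. \<exists>g\<in>G. flows_to H t x g \<and> r g \<in> V}"
proof -
  have "closed {x. \<exists>y. flows_to H b x y}"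
  proof -
    have "closed {p. flows_to H b (fst p) (snd p)}"
      by (intro closed_flows_to_preimage continuous_intros)
    from closed_compact_projection_param[OF this compact_UNIV] show ?thesis by simp
  qed
  moreover have "closed {x. \<exists>t\<in>{0..b}. \<exists>g\<in>{g \<in> G. r g \<in> - V}. flows_to H t x g}"
  proof -
    have "closed {p. flows_to H (fst (snd p)) (fst p) (snd (snd p))}"
      by (intro closed_flows_to_preimage continuous_intros)
    from closed_compact_projection_param[OF this, of "{0..b} \<times> {g \<in> G. r g \<in> - V}"]
      compact_Times[OF compact_Icc compact_closed[OF closed_guard_reset[of "- V"]]] assms(1)
    have "closed {x. \<exists>q\<in>{0..b} \<times> {g \<in> G. r g \<in> - V}. flows_to H (fst q) x (snd q)}"
      by (simp add: closed_Compl)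
    then show ?thesis by (rule back_subst[of closed]) auto
  qed
  ultimately have "open (- ({x. \<exists>y. flows_to H b x y} \<union>
      {x. \<exists>t\<in>{0..b}. \<exists>g\<in>{g \<in> G. r g \<in> - V}. flows_to H t x g}))"
    by (intro open_Compl closed_Un)
  moreover have "\<dots> = {x. \<exists>t<b. \<exists>g\<in>G. flows_to H t x g \<and> r g \<in> V}" (is "?A = ?B")
  proof (intro set_eqI iffI)
    fix x assume x: "x \<in> ?A"
    then obtain t g where g: "t < b" "g \<in> G" "flows_to H t x g"
      using flows_to_or_guard[OF assms(2), of x] by auto
    moreover have "r g \<in> V" using x g flows_to_nonneg by force
    ultimately show "x \<in> ?B" by auto
  next
    fix x assume "x \<in> ?B"
    then obtain t g where g: "t < b" "g \<in> G" "flows_to H t x g" "r g \<in> V" by auto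
    have "\<not> flows_to H b x y" for y using guard_arrival_longest[OF g(3,2), of b y] g by auto
    moreover have "r g' \<in> V" if "g' \<in> G" "flows_to H s x g'" for s g'
      using guard_arrival_unique[OF g(3,2) that(2,1)] g by auto
    ultimately show "x \<in> ?A" by auto
  qed
  ultimately show ?thesis by simp
qed

section \<open>Chains from jump steps\<close>

text \<open>
One arc of a chain together with the jump at its end.  A jump in the flow set requires that this
single arc has length at least \<open>T\<close>, which is more than a chain demands.
\<close>

definition jump_step :: "real \<Rightarrow> real \<Rightarrow> 'a \<Rightarrow> 'a \<Rightarrow> bool" where
  "jump_step \<epsilon> T p p' \<longleftrightarrow> (\<exists>t q. flows_to H t p q \<and>
     (T \<le> t \<and> q \<in> F \<and> d p' q \<le> ennreal \<epsilon> \<or> q \<in> G \<and> d p' (r q) \<le> ennreal \<epsilon>))"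

text \<open>
Lay the arcs one after the other.  The jumps in the flow set are separated by time \<open>T\<close> because each
of them is preceded by an arc of that length.
\<close>

lemma chain_of_jump_steps:
  assumes steps: "(jump_step \<epsilon> T)\<^sup>+\<^sup>+ x z" and final: "flows_to H s z y"
  shows "\<exists>c. is_chain H d \<epsilon> T c \<and> chain_from_to c x y"
proof -
  obtain k p where k: "0 < k" and p: "p 0 = x" "p k = z"
    and p_step: "\<forall>i<k. jump_step \<epsilon> T (p i) (p (Suc i))"
    using steps by (auto simp: tranclp_power relpowp_fun_conv)
  have "\<exists>tq. flows_to H (fst tq) (p i) (snd tq) \<and>
      (i = k \<longrightarrow> tq = (s, y)) \<and>
      (i < k \<longrightarrow> T \<le> fst tq \<and> snd tq \<in> F \<and> d (p (Suc i)) (snd tq) \<le> ennreal \<epsilon> \<or>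
         snd tq \<in> G \<and> d (p (Suc i)) (r (snd tq)) \<le> ennreal \<epsilon>)" if "i \<le> k" for i
  proof (cases "i = k")
    case True
    then show ?thesis using final p by auto
  next
    case False
    then have "i < k" using that by simp
    then show ?thesis using p_step unfolding jump_step_def by (metis fst_conv snd_conv less_irrefl)
  qed
  then obtain tq where tq: "\<And>i. i \<le> k \<Longrightarrow> flows_to H (fst (tq i)) (p i) (snd (tq i)) \<and>
      (i = k \<longrightarrow> tq i = (s, y)) \<and>
      (i < k \<longrightarrow> T \<le> fst (tq i) \<and> snd (tq i) \<in> F \<and> d (p (Suc i)) (snd (tq i)) \<le> ennreal \<epsilon> \<or>
         snd (tq i) \<in> G \<and> d (p (Suc i)) (r (snd (tq i))) \<le> ennreal \<epsilon>)"
    by metis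
  define t where "t i = fst (tq i)" for i
  define q where "q i = snd (tq i)" for i
  have flow: "flows_to H (t i) (p i) (q i)" if "i \<le> k" for i
    using tq[OF that] by (simp add: t_def q_def)
  have qk: "q k = y" using tq[of k] by (simp add: q_def)
  have jump: "T \<le> t i \<and> q i \<in> F \<and> d (p (Suc i)) (q i) \<le> ennreal \<epsilon> \<or>
      q i \<in> G \<and> d (p (Suc i)) (r (q i)) \<le> ennreal \<epsilon>" if "i < k" for i
    using tq[of i] that by (simp add: t_def q_def)
  have "\<exists>c. continuous_on {0..t i} c \<and> trajectory_segment H 0 (ereal (t i)) c \<and>
      c 0 = p i \<and> c (t i) = q i" if "i \<le> k" for i
    using flow[OF that] by (simp add: flows_to_def)
  then obtain c where c: "\<And>i. i \<le> k \<Longrightarrow> continuous_on {0..t i} (c i) \<and>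
      trajectory_segment H 0 (ereal (t i)) (c i) \<and> c i 0 = p i \<and> c i (t i) = q i"
    by metis
  define \<tau> where "\<tau> j = (\<Sum>i<j. t i)" for j
  define \<gamma> where "\<gamma> j u = c j (u - \<tau> j)" for j u
  define S where "S = {j \<in> {1..k}. q (j - 1) \<in> F}"
  \<comment> \<open>The initial index is \<open>0\<close> by convention, although no jump takes place there.\<close>
  define l where "l = 0 # sorted_list_of_set S"
  have [simp]: "finite S" by (simp add: S_def)
  have t_nonneg: "0 \<le> t i" if "i \<le> k" for i using flow[OF that] flows_to_nonneg by blast
  have \<tau>_Suc: "\<tau> (Suc j) = \<tau> j + t j" for j by (simp add: \<tau>_def)
  have \<tau>_mono: "\<tau> i \<le> \<tau> j" if "i \<le> j" "j \<le> k + 1" for i j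
    unfolding \<tau>_def using that t_nonneg by (intro sum_mono2) auto
  have l_sorted: "sorted_wrt (<) l"
    using strict_sorted_list_of_set[of S] by (auto simp: l_def S_def)
  have l_length: "length l = Suc (card S)" by (simp add: l_def)
  have l_S: "(\<exists>m\<in>{1..card S}. j = l ! m) \<longleftrightarrow> j \<in> S" for j
  proof
    assume "\<exists>m\<in>{1..card S}. j = l ! m"
    then obtain m where m: "1 \<le> m" "m \<le> card S" "j = l ! m" by auto
    then have "j = sorted_list_of_set S ! (m - 1)" by (cases m) (auto simp: l_def)
    moreover have "m - 1 < length (sorted_list_of_set S)" using m by simp
    ultimately have "j \<in> set (sorted_list_of_set S)" using nth_mem by blast
    then show "j \<in> S" by simp
  next
    assume "j \<in> S"
    then have "j \<in> set (sorted_list_of_set S)" by simp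
    then obtain m where "m < card S" "j = sorted_list_of_set S ! m"
      unfolding in_set_conv_nth by auto
    then show "\<exists>m\<in>{1..card S}. j = l ! m"
      by (intro bexI[of _ "Suc m"]) (auto simp: l_def)
  qed
  have S_time: "T \<le> t (j - 1)" if "j \<in> S" for j
  proof -
    have "j - 1 < k" "q (j - 1) \<in> F" using that by (simp_all add: S_def, linarith)
    then show ?thesis using jump[of "j - 1"] guard_not_flow[of "q (j - 1)"] by blast
  qed
  define C where "C = \<lparr>chain_jumps = k, chain_time = \<tau>, last_cont = card S,
     cont_index = (!) l, chain_arc = \<gamma>\<rparr>"
  have "is_chain H d \<epsilon> T C"
    unfolding is_chain_def C_def Let_def chain.simps
  proof (intro conjI ballI)
    show "1 \<le> k" using k by simp
    show "\<tau> 0 = 0" by (simp add: \<tau>_def)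
    show "mono_on {0..k + 1} \<tau>" using \<tau>_mono by (auto simp: mono_on_def)
    show "l ! 0 = 0" by (simp add: l_def)
    show "strict_mono_on {0..card S} ((!) l)"
      using l_sorted by (auto simp: strict_mono_on_def l_length sorted_wrt_nth_less)
    have "l ! card S \<in> set l" by (rule nth_mem) (simp add: l_length)
    then show "l ! card S \<le> k" by (auto simp: l_def S_def)
  next
    fix m assume m: "m \<in> {1..card S}"
    then have S: "l ! m \<in> S" using l_S by blast
    have "l ! (m - 1) < l ! m" using m by (intro sorted_wrt_nth_less[OF l_sorted]) (auto simp: l_length)
    then have le: "l ! (m - 1) \<le> l ! m - 1" by simp
    have "l ! m \<le> k" "1 \<le> l ! m" using S by (auto simp: S_def)
    then have "\<tau> (l ! (m - 1)) \<le> \<tau> (l ! m - 1)" using le by (intro \<tau>_mono) auto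
    moreover have "\<tau> (l ! m) = \<tau> (l ! m - 1) + t (l ! m - 1)"
      using \<tau>_Suc[of "l ! m - 1"] \<open>1 \<le> l ! m\<close> by simp
    ultimately show "T \<le> \<tau> (l ! m) - \<tau> (l ! (m - 1))" using S_time[OF S] by simp
  next
    fix j assume "j \<in> {0..k}"
    then have j: "j \<le> k" by simp
    show "continuous_on {\<tau> j..\<tau> (j + 1)} (\<gamma> j)"
      unfolding \<gamma>_def
      by (rule continuous_on_compose2[of "{0..t j}"])
        (use c[OF j] \<tau>_Suc[of j] in \<open>auto intro!: continuous_intros\<close>)
    show "trajectory_segment H (\<tau> j) (ereal (\<tau> (j + 1))) (\<gamma> j)"
      unfolding trajectory_segment_def
    proof (intro allI impI)
      fix u assume "\<tau> j \<le> u \<and> ereal u < ereal (\<tau> (j + 1))"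
      then have "0 \<le> u - \<tau> j \<and> ereal (u - \<tau> j) < ereal (t j)" using \<tau>_Suc[of j] by simp
      then have "c j (u - \<tau> j) \<in> F \<and> (u - \<tau> j - 0, c j 0) \<in> D \<and>
          c j (u - \<tau> j) = \<phi> (u - \<tau> j - 0) (c j 0)"
        using c[OF j] unfolding trajectory_segment_def by blast
      then show "\<gamma> j u \<in> F \<and> (u - \<tau> j, \<gamma> j (\<tau> j)) \<in> D \<and> \<gamma> j u = \<phi> (u - \<tau> j) (\<gamma> j (\<tau> j))"
        unfolding \<gamma>_def diff_self diff_0_right .
    qed
  next
    fix j assume "j \<in> {1..k}"
    then have j: "1 \<le> j" "j \<le> k" by auto
    have pre: "\<gamma> (j - 1) (\<tau> j) = q (j - 1)" "\<gamma> j (\<tau> j) = p j"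
      using c[of "j - 1"] c[of j] \<tau>_Suc[of "j - 1"] j by (auto simp: \<gamma>_def)
    have "j - 1 < k" using j by linarith
    then have jump_before: "T \<le> t (j - 1) \<and> q (j - 1) \<in> F \<and> d (p j) (q (j - 1)) \<le> ennreal \<epsilon> \<or>
        q (j - 1) \<in> G \<and> d (p j) (r (q (j - 1))) \<le> ennreal \<epsilon>"
      using jump[of "j - 1"] j by simp
    show "if \<exists>m\<in>{1..card S}. j = l ! m
      then \<gamma> (j - 1) (\<tau> j) \<in> F \<and> d (\<gamma> j (\<tau> j)) (\<gamma> (j - 1) (\<tau> j)) \<le> ennreal \<epsilon>
      else \<gamma> (j - 1) (\<tau> j) \<in> G \<and> d (\<gamma> j (\<tau> j)) (r (\<gamma> (j - 1) (\<tau> j))) \<le> ennreal \<epsilon>"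
      unfolding l_S pre using jump_before j guard_not_flow[of "q (j - 1)"]
      by (auto simp: S_def)
  qed
  moreover have "chain_from_to C x y"
    using c[of 0] c[of k] k p qk \<tau>_Suc[of k] by (simp add: chain_from_to_def C_def \<gamma>_def \<tau>_def)
  ultimately show ?thesis by blast
qed

section \<open>An attracting set where chains fail\<close>

text \<open>
Flow for time \<open>T\<close>, unless the guard is met within \<open>2 * T\<close>; then go there and reset.  The
threshold \<open>2 * T\<close> keeps the endpoint of the first alternative in the flow set, where a jump is
permitted.
\<close>

definition forced_step :: "real \<Rightarrow> 'a \<Rightarrow> 'a \<Rightarrow> bool" where
  "forced_step T z w \<longleftrightarrow> (\<exists>y. flows_to H (2 * T) z y) \<and> flows_to H T z w \<or>
     (\<exists>t\<in>{0..2 * T}. \<exists>g\<in>G. flows_to H t z g \<and> w = r g)"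

lemma forced_step_total:
  assumes "0 < T"
  obtains n t w where "forced_step T z w" "reaches H n t z w" "real n + t \<le> 2 * T + 1"
proof -
  consider y where "flows_to H (2 * T) z y" | t g where "t < 2 * T" "g \<in> G" "flows_to H t z g"
    using flows_to_or_guard[of "2 * T" z] assms by auto
  then show ?thesis
  proof cases
    case 1
    obtain w where w: "flows_to H T z w" "flows_to H (2 * T - T) w y"
      using flows_to_split[of "2 * T - T" T z y] 1 assms by auto
    show ?thesis
      using that[of w 0 T] w(1) 1 assms by (auto simp: forced_step_def)
  next
    case 2
    show ?thesis
      by (rule that[of "r g" 1 t])
        (use 2 flows_to_nonneg[OF 2(3)] in \<open>auto simp: forced_step_def intro!: exI[of _ t] bexI[of _ g]\<close>)
  qed
qed

lemma forced_step_jump_step: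
  assumes "0 < T" "forced_step T z w" "d w p < ennreal \<epsilon>"
  shows "jump_step \<epsilon> T z p"
proof -
  have close: "d p w \<le> ennreal \<epsilon>" using assms(3) dist_sym[of p w] by simp
  show ?thesis
    using assms(2) unfolding forced_step_def
  proof (elim disjE)
    assume "(\<exists>y. flows_to H (2 * T) z y) \<and> flows_to H T z w"
    then obtain y where y: "flows_to H (2 * T) z y" and w: "flows_to H T z w" by auto
    have "flows_to H (2 * T - T) w y" using flows_to_remainder[OF w y] assms(1) by simp
    then have "w \<in> F" using flows_to_start_flow_set assms(1) by fastforce
    then show ?thesis
      unfolding jump_step_def using w close by (auto intro!: exI[of _ T] exI[of _ w])
  next
    assume "\<exists>t\<in>{0..2 * T}. \<exists>g\<in>G. flows_to H t z g \<and> w = r g"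
    then show ?thesis
      unfolding jump_step_def using close by auto
  qed
qed

text \<open>
\<open>N\<close> collects the endpoints of chains of forced steps, each followed by a jump of size less than
\<open>\<epsilon>\<close>.  It is open because the last jump is free, and for the same reason it contains the closure \<open>Q\<close> of
all endpoints of forced steps from \<open>N\<close>.  Hence forced steps preserve \<open>Q\<close>, and orbits that start in
\<open>Q\<close> stay in the closed set \<open>B\<close> of points at flow time at most \<open>2 * T\<close> from \<open>Q\<close>.

The set \<open>V\<close> consists of states from which \<open>N\<close> is entered in bounded time by an arc or by an arc
and a reset; each of these is an open condition.  It contains \<open>B\<close> because a point of \<open>B\<close> is
on its way to the next forced step of a point of \<open>Q\<close>.  One forced step after entering \<open>N\<close> the orbit is
in \<open>Q\<close>, so all orbits from \<open>V\<close> are in \<open>B\<close> after a bounded time, and their union \<open>W\<close> is a trapping set.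
Every point of \<open>B\<close> is the end of an \<open>(\<epsilon>, T)\<close>-chain from \<open>x\<close>; so \<open>y\<close> is not in \<open>B\<close>, which contains the
attracting set of \<open>W\<close>.
\<close>

lemma separating_attractor:
  assumes "\<not> conley_relation H d x y"
  shows "\<exists>A. attracting_set H A \<and> y \<notin> A \<and> x \<notin> dual_repelling_set H A"
proof -
  obtain \<epsilon> T where \<epsilon>: "0 < \<epsilon>" and T: "0 < T"
    and no_chain: "\<nexists>c. is_chain H d \<epsilon> T c \<and> chain_from_to c x y"
    using assms by (auto simp: conley_relation_def)
  define near_step where "near_step z p \<longleftrightarrow> (\<exists>w. forced_step T z w \<and> d w p < ennreal \<epsilon>)" for z p
  define N where "N = {p. near_step\<^sup>+\<^sup>+ x p}"
  define Q where "Q = closure {w. \<exists>z\<in>insert x N. forced_step T z w}"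
  define B where "B = {y. \<exists>q\<in>Q. \<exists>s\<in>{0..2 * T}. flows_to H s q y}"
  define V where "V = {p. \<exists>t<3 * T. \<exists>g\<in>G. flows_to H t p g \<and> r g \<in> N} \<union>
    {p. \<exists>s\<in>{0..T}. \<exists>w\<in>N \<inter> F. flows_to H s p w}"
  define W where "W = {y. \<exists>p\<in>V. \<exists>n t. reaches H n t p y}"

  have N_step: "p \<in> N" if "z \<in> insert x N" "forced_step T z w" "d w p < ennreal \<epsilon>" for z w p
  proof -
    have "near_step z p" using that by (auto simp: near_step_def)
    then show ?thesis using that(1) by (auto simp: N_def)
  qed
  \<comment> \<open>The last jump of a chain of forced steps may end anywhere in a ball.\<close>
  have N_open: "open N"
  proof (subst open_subopen, intro ballI)
    fix p assume "p \<in> N"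
    then obtain z where z: "z \<in> insert x N" "near_step z p"
      unfolding N_def by (auto elim: tranclp.cases)
    then obtain w where w: "forced_step T z w" "d w p < ennreal \<epsilon>" by (auto simp: near_step_def)
    then show "\<exists>U. open U \<and> p \<in> U \<and> U \<subseteq> N"
      using N_step[OF z(1) w(1)] open_dist_ball[of w "ennreal \<epsilon>"]
      by (intro exI[of _ "{p. d w p < ennreal \<epsilon>}"]) auto
  qed
  have QN: "Q \<subseteq> N"
  proof
    fix q assume "q \<in> Q"
    then obtain w z where "z \<in> insert x N" "forced_step T z w" "d w q < ennreal \<epsilon>"
      using closure_dist[of q _ "ennreal \<epsilon>"] \<epsilon> unfolding Q_def by (fastforce simp: dist_sym)
    then show "q \<in> N" by (rule N_step)
  qed
  have step_Q: "w \<in> Q" if "z \<in> insert x N" "forced_step T z w" for z w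
    unfolding Q_def using that closure_subset by fastforce
  \<comment> \<open>As long as the guard is more than \<open>2 * T\<close> away, an arc can be advanced by forced steps of length \<open>T\<close>.
    So every arc from \<open>Q\<close> can be restarted in \<open>Q\<close> at a time at most \<open>2 * T\<close> before its end.\<close>
  have rebase: "\<exists>q'\<in>Q. \<exists>s'\<in>{0..2 * T}. flows_to H s' q' y"
    if "q \<in> Q" "flows_to H s q y" "s \<le> real k * T" for k q s y
    using that
  proof (induction k arbitrary: q s)
    case 0
    then show ?case using T flows_to_nonneg[OF "0.prems"(2)]
      by (intro bexI[of _ q] bexI[of _ s]) auto
  next
    case (Suc k)
    show ?case
    proof (cases "s \<le> 2 * T")
      case True
      then show ?thesis using Suc.prems flows_to_nonneg by (intro bexI[of _ q] bexI[of _ s]) auto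
    next
      case False
      obtain z where z: "flows_to H (2 * T) q z"
        using flows_to_split[of "s - 2 * T" "2 * T" q y] Suc.prems False T by auto
      obtain w where w: "flows_to H T q w" "flows_to H (s - T) w y"
        using flows_to_split[of "s - T" T q y] Suc.prems False T by auto
      have "w \<in> Q" using step_Q[of q w] Suc.prems QN z w by (auto simp: forced_step_def)
      then show ?thesis using Suc.IH[OF _ w(2)] Suc.prems(3) by (simp add: algebra_simps)
    qed
  qed
  have rebase: "\<exists>q'\<in>Q. \<exists>s'\<in>{0..2 * T}. flows_to H s' q' y" if "q \<in> Q" "flows_to H s q y" for q s y
  proof -
    have "s \<le> real (nat \<lceil>s / T\<rceil>) * T"
      using T by (metis pos_divide_le_eq real_nat_ceiling_ge)
    then show ?thesis using rebase that by blast
  qed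
  have stays: "y \<in> B" if "q \<in> Q" "reaches H n t q y" for n t q y
    using that
  proof (induction n arbitrary: q t)
    case 0
    then show ?case using rebase[of q t y] by (auto simp: B_def)
  next
    case (Suc n)
    then obtain s g where g: "g \<in> G" "flows_to H s q g" "reaches H n (t - s) (r g) y" by auto
    obtain q' s' where q': "q' \<in> Q" "s' \<in> {0..2 * T}" "flows_to H s' q' g"
      using rebase[OF Suc.prems(1) g(2)] by auto
    then have "forced_step T q' (r g)" using g(1) by (auto simp: forced_step_def)
    then have "r g \<in> Q" using step_Q q'(1) QN by auto
    then show ?case using Suc.IH g(3) by blast
  qed
  have B_closed: "closed B" unfolding B_def by (rule closed_flow_image) (simp add: Q_def)
  have V_open: "open V"
    unfolding V_def using T by (intro open_Un open_resets_into open_flows_into N_open) simp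
  \<comment> \<open>An arc longer than \<open>T\<close> that does not meet the guard by \<open>2 * T\<close> is first cut at time \<open>T\<close>,
    where it is in \<open>Q\<close>; this case is reduced to the present one below.\<close>
  have short: "b \<in> V" if q: "q \<in> Q" and s: "0 \<le> s" "s \<le> 2 * T" and b: "flows_to H s q b"
    and *: "s \<le> T \<or> (\<exists>t<2 * T. \<exists>g\<in>G. flows_to H t q g)" for q s b
  proof (cases "\<exists>t<2 * T. \<exists>g\<in>G. flows_to H t q g")
    case True
    then obtain t g where g: "t < 2 * T" "g \<in> G" "flows_to H t q g" by auto
    have "s \<le> t" using guard_arrival_longest[OF g(3,2) b] .
    then have "flows_to H (t - s) b g" using flows_to_remainder[OF b g(3)] by simp
    moreover have "forced_step T q (r g)"
      using g flows_to_nonneg[OF g(3)] by (auto simp: forced_step_def intro!: bexI[of _ t] bexI[of _ g])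
    then have "r g \<in> N" using step_Q[of q] q QN by auto
    moreover have "t - s < 3 * T" using g s T by simp
    ultimately show ?thesis using g unfolding V_def by blast
  next
    case False
    then have sT: "s \<le> T" using * by blast
    obtain z where z: "flows_to H (2 * T) q z"
      using flows_to_or_guard[of "2 * T" q] False T by auto
    obtain w where w: "flows_to H T q w" "flows_to H (2 * T - T) w z"
      using flows_to_split[of "2 * T - T" T q z] z T by auto
    have "w \<in> N" using step_Q[of q w] q QN z w by (auto simp: forced_step_def)
    moreover have "w \<in> F" using flows_to_start_flow_set[OF w(2)] T by simp
    moreover have "flows_to H (T - s) b w" using flows_to_remainder[OF b w(1) sT] .
    ultimately show ?thesis using s sT unfolding V_def by (auto intro!: bexI[of _ "T - s"])
  qed
  have BV: "B \<subseteq> V"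
  proof
    fix b assume "b \<in> B"
    then obtain q s where q: "q \<in> Q" "s \<in> {0..2 * T}" "flows_to H s q b" by (auto simp: B_def)
    show "b \<in> V"
    proof (cases "s \<le> T \<or> (\<exists>t<2 * T. \<exists>g\<in>G. flows_to H t q g)")
      case True
      then show ?thesis using short[of q s b] q by auto
    next
      case False
      obtain z where z: "flows_to H (2 * T) q z"
        using flows_to_or_guard[of "2 * T" q] False T by auto
      obtain w where w: "flows_to H T q w" "flows_to H (s - T) w b"
        using flows_to_split[of "s - T" T q b] q False T by auto
      have "w \<in> Q" using step_Q[of q w] q QN z w by (auto simp: forced_step_def)
      then show ?thesis using short[of w "s - T" b] w(2) q False T by auto
    qed
  qed
  have enters_Q: "\<exists>n t q. reaches H n t z q \<and> q \<in> Q \<and> real n + t \<le> 2 * T + 1" if "z \<in> insert x N" for z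
    using forced_step_total[OF T, of z] step_Q[OF that] by metis
  have V_enters: "\<exists>n t q. reaches H n t p q \<and> q \<in> Q \<and> real n + t \<le> 5 * T + 2" if "p \<in> V" for p
  proof -
    obtain m s z where z: "reaches H m s p z" "z \<in> N" "real m + s \<le> 3 * T + 1"
    proof -
      from \<open>p \<in> V\<close> consider t g where "t < 3 * T" "g \<in> G" "flows_to H t p g" "r g \<in> N"
        | s w where "s \<in> {0..T}" "w \<in> N" "flows_to H s p w"
        by (auto simp: V_def)
      then show ?thesis
      proof cases
        case 1
        then have "reaches H 1 t p (r g)" by (auto intro!: exI[of _ t] bexI[of _ g])
        then show ?thesis using that[of 1 t "r g"] 1 by simp
      next
        case 2
        then show ?thesis using that[of 0 s w] T by simp
      qed
    qed
    obtain n t q where "reaches H n t z q" "q \<in> Q" "real n + t \<le> 2 * T + 1"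
      using enters_Q[of z] z(2) by auto
    then show ?thesis
      using reaches_trans[OF z(1), of n t q] z(3)
      by (intro exI[of _ "m + n"] exI[of _ "s + t"] exI[of _ q]) auto
  qed
  have tail: "omega_tail H W (5 * T + 2) \<subseteq> B"
    unfolding omega_tail_reaches
  proof (rule closure_minimal[OF _ B_closed], safe)
    fix b y n t assume "y \<in> W" and b: "reaches H n t y b" "5 * T + 2 \<le> real n + t"
    then obtain p m s where p: "p \<in> V" "reaches H m s p y" by (auto simp: W_def)
    obtain n' t' q where q: "reaches H n' t' p q" "q \<in> Q" "real n' + t' \<le> 5 * T + 2"
      using V_enters[OF p(1)] by auto
    have "reaches H (m + n) (s + t) p b" using reaches_trans[OF p(2) b(1)] .
    from reaches_remainder[OF q(1) this] show "b \<in> B"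
      using q(3) b(2) reaches_nonneg[OF p(2)] stays[OF q(2)] by auto
  qed
  have VW: "V \<subseteq> W"
  proof
    fix p assume "p \<in> V"
    moreover have "reaches H 0 0 p p" by simp
    ultimately show "p \<in> W" unfolding W_def by blast
  qed
  have trapping: "trapping_set H W"
    unfolding trapping_set_def
  proof (intro conjI exI[of _ "5 * T + 2"])
    show "compact (closure W)" by (simp add: compact_closed)
    show "forward_invariant H W"
      unfolding forward_invariant_reaches W_def using reaches_trans by blast
    show "omega_tail H W (5 * T + 2) \<subseteq> interior W"
      using tail BV interior_maximal[OF VW V_open] by blast
  qed (use T in simp)
  define A where "A = omega_limit H W"
  have "attracting_set H A" using trapping by (auto simp: attracting_set_def A_def)
  moreover have "y \<notin> A"
  proof
    assume "y \<in> A"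
    then have "y \<in> B" using tail T by (auto simp: A_def omega_limit_def)
    then obtain q s where q: "q \<in> Q" "flows_to H s q y" by (auto simp: B_def)
    then have "near_step\<^sup>+\<^sup>+ x q" using QN by (auto simp: N_def)
    then have "(jump_step \<epsilon> T)\<^sup>+\<^sup>+ x q"
    proof (induction rule: tranclp_induct)
      case (base p)
      then show ?case using forced_step_jump_step[OF T] by (auto simp: near_step_def)
    next
      case (step p p')
      then have "jump_step \<epsilon> T p p'" using forced_step_jump_step[OF T] unfolding near_step_def by blast
      with step.IH show ?case by (rule tranclp.trancl_into_trancl)
    qed
    then show False using chain_of_jump_steps[OF _ q(2)] no_chain by blast
  qed
  moreover have "x \<notin> dual_repelling_set H A"
  proof -
    obtain n t q where q: "reaches H n t x q" "q \<in> Q" using enters_Q[of x] by auto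
    have "reaches H 0 0 q q" by simp
    then have "q \<in> W" using stays[OF q(2)] BV VW by blast
    then have "omega_limit H {x} \<subseteq> A" unfolding A_def by (rule omega_limit_reaches_mono[OF q(1)])
    then show ?thesis using omega_limit_nonempty[of x] by (auto simp: dual_repelling_set_def)
  qed
  ultimately show ?thesis by blast
qed

section \<open>Chains as pseudo-orbits\<close>

text \<open>
Every endpoint of a chain arises in this way, one move at a time: after \<open>n\<close> jumps of either kind, with \<open>a\<close> the
flow time since the last jump in place.  Flow is added in pieces of length at most \<open>1\<close>, so that
no move advances \<open>n\<close> plus the flow time by more than one.
\<close>

inductive pseudo_reaches :: "real \<Rightarrow> real \<Rightarrow> 'a \<Rightarrow> nat \<Rightarrow> real \<Rightarrow> 'a \<Rightarrow> bool"
  for \<epsilon> T x where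
  start: "pseudo_reaches \<epsilon> T x 0 0 x"
| flow: "pseudo_reaches \<epsilon> T x n a p \<Longrightarrow> flows_to H t p q \<Longrightarrow> t \<le> 1 \<Longrightarrow>
    pseudo_reaches \<epsilon> T x n (a + t) q"
| reset: "pseudo_reaches \<epsilon> T x n a g \<Longrightarrow> g \<in> G \<Longrightarrow> d w (r g) \<le> ennreal \<epsilon> \<Longrightarrow>
    pseudo_reaches \<epsilon> T x (Suc n) a w"
| jump: "pseudo_reaches \<epsilon> T x n a z \<Longrightarrow> T \<le> a \<Longrightarrow> d w z \<le> ennreal \<epsilon> \<Longrightarrow>
    pseudo_reaches \<epsilon> T x (Suc n) 0 w"

lemma pseudo_reaches_age_nonneg: "pseudo_reaches \<epsilon> T x n a p \<Longrightarrow> 0 \<le> a"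
  by (induction rule: pseudo_reaches.induct) (auto dest: flows_to_nonneg)

lemma pseudo_reaches_flow:
  assumes "pseudo_reaches \<epsilon> T x n a p" "flows_to H t p q"
  shows "pseudo_reaches \<epsilon> T x n (a + t) q"
proof -
  have "pseudo_reaches \<epsilon> T x n (a + t) q"
    if "pseudo_reaches \<epsilon> T x n a p" "flows_to H t p q" "t \<le> real k" for k a p t
    using that
  proof (induction k arbitrary: a p t)
    case 0
    then show ?case using pseudo_reaches.flow[OF "0.prems"(1,2)] by simp
  next
    case (Suc k)
    show ?case
    proof (cases "t \<le> 1")
      case True
      then show ?thesis using pseudo_reaches.flow[OF Suc.prems(1,2)] by simp
    next
      case False
      obtain m where m: "flows_to H 1 p m" "flows_to H (t - 1) m q"
        using flows_to_split[of "t - 1" 1 p q] Suc.prems False by auto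
      have "pseudo_reaches \<epsilon> T x n (a + 1) m" by (rule pseudo_reaches.flow[OF Suc.prems(1) m(1)]) simp
      from Suc.IH[OF this m(2)] Suc.prems(3) show ?thesis by simp
    qed
  qed
  moreover have "t \<le> real (nat \<lceil>t\<rceil>)" by linarith
  ultimately show ?thesis using assms by blast
qed

text \<open>
After concatenation the time since the last jump in place can only be longer, so later
jumps remain permitted.
\<close>

lemma pseudo_reaches_trans:
  assumes "pseudo_reaches \<epsilon> T p m b q" "pseudo_reaches \<epsilon> T x n a p"
  shows "\<exists>c\<ge>b. pseudo_reaches \<epsilon> T x (n + m) c q"
  using assms(1)
proof (induction rule: pseudo_reaches.induct)
  case start
  then show ?case using assms(2) pseudo_reaches_age_nonneg[OF assms(2)] by auto
next
  case (flow m b p t q)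
  then obtain c where "b \<le> c" "pseudo_reaches \<epsilon> T x (n + m) c p" by auto
  then show ?case using pseudo_reaches.flow[of \<epsilon> T x _ c p t q] flow by (intro exI[of _ "c + t"]) auto
next
  case (reset m b g w)
  then show ?case using pseudo_reaches.reset by fastforce
next
  case (jump m b z w)
  then obtain c where "b \<le> c" "pseudo_reaches \<epsilon> T x (n + m) c z" by auto
  then show ?case using pseudo_reaches.jump[of \<epsilon> T x _ c z w] jump by auto
qed

text \<open>
Along the chain the age is the time since \<open>\<tau> (\<eta> k)\<close>, where \<open>k\<close> is the last index with \<open>\<eta> k \<le> j\<close>.
\<close>

lemma chain_pseudo_reaches:
  assumes chain: "is_chain H d \<epsilon> T c" "chain_from_to c x y"
  shows "\<exists>n\<ge>1. \<exists>a. pseudo_reaches \<epsilon> T x n a y"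
proof -
  obtain N \<tau> M \<eta> \<gamma> where c: "c = \<lparr>chain_jumps = N, chain_time = \<tau>, last_cont = M,
     cont_index = \<eta>, chain_arc = \<gamma>\<rparr>"
    by (cases c)
  note chain_conditions = chain(1)[unfolded is_chain_def c Let_def chain.simps]
  have N: "1 \<le> N" and \<tau>0: "\<tau> 0 = 0" and \<tau>_mono: "mono_on {0..N + 1} \<tau>" and \<eta>0: "\<eta> 0 = 0"
    and \<eta>_mono: "strict_mono_on {0..M} \<eta>"
    using chain_conditions by blast+
  have spaced: "T \<le> \<tau> (\<eta> k) - \<tau> (\<eta> (k - 1))" if "k \<in> {1..M}" for k
    using chain_conditions that by blast
  have arcs: "continuous_on {\<tau> j..\<tau> (Suc j)} (\<gamma> j)"
      "trajectory_segment H (\<tau> j) (ereal (\<tau> (Suc j))) (\<gamma> j)" if "j \<le> N" for j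
    using chain_conditions that by auto
  have jumps: "if \<exists>k\<in>{1..M}. j = \<eta> k
      then \<gamma> (j - 1) (\<tau> j) \<in> F \<and> d (\<gamma> j (\<tau> j)) (\<gamma> (j - 1) (\<tau> j)) \<le> ennreal \<epsilon>
      else \<gamma> (j - 1) (\<tau> j) \<in> G \<and> d (\<gamma> j (\<tau> j)) (r (\<gamma> (j - 1) (\<tau> j))) \<le> ennreal \<epsilon>"
    if "j \<in> {1..N}" for j
    using chain_conditions that by blast
  have xy: "\<gamma> 0 0 = x" "\<gamma> N (\<tau> (Suc N)) = y" using chain(2) by (auto simp: chain_from_to_def c)
  have arc: "flows_to H (\<tau> (Suc j) - \<tau> j) (\<gamma> j (\<tau> j)) (\<gamma> j (\<tau> (Suc j)))" if "j \<le> N" for j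
    using that arcs mono_onD[OF \<tau>_mono, of j "Suc j"] by (intro flows_to_segment) auto
  have less: "\<eta> k < \<eta> k'" if "k < k'" "k' \<le> M" for k k'
    using strict_mono_onD[OF \<eta>_mono, of k k'] that by auto
  have "\<exists>k\<le>M. \<eta> k \<le> j \<and> (\<forall>k'\<in>{1..M}. \<eta> k' \<le> j \<longrightarrow> k' \<le> k) \<and>
      pseudo_reaches \<epsilon> T x j (\<tau> j - \<tau> (\<eta> k)) (\<gamma> j (\<tau> j))" if "j \<le> N" for j
    using that
  proof (induction j)
    case 0
    have "\<not> \<eta> k' \<le> 0" if "k' \<in> {1..M}" for k' using less[of 0 k'] that by auto
    then show ?case using \<tau>0 \<eta>0 xy pseudo_reaches.start by (intro exI[of _ 0]) auto
  next
    case (Suc j)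
    then obtain k where k: "k \<le> M" "\<eta> k \<le> j" "\<forall>k'\<in>{1..M}. \<eta> k' \<le> j \<longrightarrow> k' \<le> k"
      "pseudo_reaches \<epsilon> T x j (\<tau> j - \<tau> (\<eta> k)) (\<gamma> j (\<tau> j))" by auto
    have reach: "pseudo_reaches \<epsilon> T x j (\<tau> (Suc j) - \<tau> (\<eta> k)) (\<gamma> j (\<tau> (Suc j)))"
      using pseudo_reaches_flow[OF k(4) arc] Suc.prems by simp
    show ?case
    proof (cases "\<exists>k'\<in>{1..M}. Suc j = \<eta> k'")
      case True
      then obtain k' where k': "1 \<le> k'" "k' \<le> M" "Suc j = \<eta> k'" by auto
      have "\<eta> (k' - 1) \<le> j" using less[of "k' - 1" k'] k' by auto
      moreover have "k' - 1 \<in> {1..M}" if "k' \<noteq> 1" using that k' by auto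
      ultimately have "k' - 1 \<le> k" using k(3) by (cases "k' = 1") auto
      moreover have "k < k'" using less[of k' k] k k' by (cases k k' rule: linorder_cases) auto
      ultimately have "k = k' - 1" by simp
      then have age: "T \<le> \<tau> (Suc j) - \<tau> (\<eta> k)" using spaced[of k'] k' by simp
      have "d (\<gamma> (Suc j) (\<tau> (Suc j))) (\<gamma> j (\<tau> (Suc j))) \<le> ennreal \<epsilon>"
        using jumps[of "Suc j"] Suc.prems True by simp
      from pseudo_reaches.jump[OF reach age this]
      have "pseudo_reaches \<epsilon> T x (Suc j) (\<tau> (Suc j) - \<tau> (\<eta> k')) (\<gamma> (Suc j) (\<tau> (Suc j)))"
        using k' by simp
      moreover have "k'' \<le> k'" if "k'' \<in> {1..M}" "\<eta> k'' \<le> Suc j" for k''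
        using less[of k' k''] that k' by (cases k'' k' rule: linorder_cases) auto
      ultimately show ?thesis using k' by (intro exI[of _ k']) auto
    next
      case False
      then have "\<gamma> j (\<tau> (Suc j)) \<in> G" "d (\<gamma> (Suc j) (\<tau> (Suc j))) (r (\<gamma> j (\<tau> (Suc j)))) \<le> ennreal \<epsilon>"
        using jumps[of "Suc j"] Suc.prems by simp_all
      from pseudo_reaches.reset[OF reach this]
      show ?thesis using k False by (intro exI[of _ k]) (auto simp: le_Suc_eq)
    qed
  qed
  then obtain a where "pseudo_reaches \<epsilon> T x N a (\<gamma> N (\<tau> N))" by blast
  from pseudo_reaches_flow[OF this arc[of N]] show ?thesis using xy N by auto
qed

section \<open>Shadowing of pseudo-orbits\<close>

text \<open>
The flag tells a reset from a jump in place, which is made without a reset; \<open>\<delta>\<close> bounds the error.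
\<close>

definition faulty_jump :: "bool \<Rightarrow> real \<Rightarrow> 'a \<Rightarrow> 'a \<Rightarrow> bool" where
  "faulty_jump b \<delta> z w \<longleftrightarrow> (if b then z \<in> G \<and> d w (r z) \<le> ennreal \<delta> else d w z \<le> ennreal \<delta>)"

text \<open>
A pseudo-orbit with error \<open>\<delta>\<close> carries the word of kinds of its jumps.  For a fixed word it is built by
finitely many quantifiers over compact sets, which makes it closed jointly in \<open>\<delta>\<close> and the other
parameters; at \<open>\<delta> = 0\<close> jumps in place disappear and a true orbit remains.
\<close>

primrec pseudo_orbit :: "real \<Rightarrow> bool list \<Rightarrow> real \<Rightarrow> 'a \<Rightarrow> 'a \<Rightarrow> bool" where
  "pseudo_orbit \<delta> [] t x y \<longleftrightarrow> flows_to H t x y"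
| "pseudo_orbit \<delta> (b # bs) t x y \<longleftrightarrow>
    (\<exists>s z w. flows_to H s x z \<and> faulty_jump b \<delta> z w \<and> pseudo_orbit \<delta> bs (t - s) w y)"

lemma pseudo_orbit_nonneg: "pseudo_orbit \<delta> bs t x y \<Longrightarrow> 0 \<le> t"
proof (induction bs arbitrary: t x)
  case (Cons b bs)
  then show ?case using flows_to_nonneg by force
qed (simp add: flows_to_nonneg)

lemma pseudo_orbit_trans:
  "pseudo_orbit \<delta> bs t x y \<Longrightarrow> pseudo_orbit \<delta> bs' t' y z \<Longrightarrow> pseudo_orbit \<delta> (bs @ bs') (t + t') x z"
proof (induction bs arbitrary: t x)
  case Nil
  show ?case
  proof (cases bs')
    case Nil
    then show ?thesis using Nil.prems flows_to_append by simp
  next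
    case (Cons b cs)
    then obtain s u w where "flows_to H s y u"
      "faulty_jump b \<delta> u w"
      "pseudo_orbit \<delta> cs (t' - s) w z" using Nil.prems by auto
    then have "flows_to H (t + s) x u \<and> faulty_jump b \<delta> u w \<and>
        pseudo_orbit \<delta> cs (t + t' - (t + s)) w z"
      using Nil.prems(1) flows_to_append[of t x y s u] by simp
    then show ?thesis unfolding Cons append_Nil pseudo_orbit.simps by blast
  qed
next
  case (Cons b bs)
  then obtain s u w where u: "flows_to H s x u"
      "faulty_jump b \<delta> u w"
      "pseudo_orbit \<delta> bs (t - s) w y" by auto
  have "pseudo_orbit \<delta> (bs @ bs') (t - s + t') w z" by (rule Cons.IH[OF u(3) Cons.prems(2)])
  then have "pseudo_orbit \<delta> (bs @ bs') (t + t' - s) w z" by (simp add: algebra_simps)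
  then show ?case using u(1,2) by auto
qed

lemma pseudo_orbit_append_jump:
  assumes "pseudo_orbit \<delta> bs t x z"
    and "faulty_jump b \<delta> z w"
  shows "pseudo_orbit \<delta> (bs @ [b]) t x w"
proof -
  have "pseudo_orbit \<delta> [b] 0 z w"
  proof -
    have "flows_to H 0 z z \<and> faulty_jump b \<delta> z w \<and> flows_to H (0 - 0) w w" using assms(2) by simp
    then show ?thesis unfolding pseudo_orbit.simps by blast
  qed
  from pseudo_orbit_trans[OF assms(1) this] show ?thesis by simp
qed

lemma exact_pseudo_orbit: "pseudo_orbit 0 bs t x y \<Longrightarrow> reaches H (length (filter id bs)) t x y"
proof (induction bs arbitrary: t x)
  case (Cons b bs)
  then obtain s u w where u: "flows_to H s x u"
      "faulty_jump b 0 u w"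
      "pseudo_orbit 0 bs (t - s) w y" by auto
  show ?case
  proof (cases b)
    case True
    then show ?thesis using u Cons.IH[OF u(3)] by (auto simp: faulty_jump_def)
  next
    case False
    then show ?thesis using u reaches_prepend_flow[OF u(1), of _ "t - s"] Cons.IH[OF u(3)]
      by (auto simp: faulty_jump_def)
  qed
qed simp

text \<open>
The bound \<open>B\<close> on the flow time confines the length of the first arc to a compact interval.
\<close>

lemma closed_pseudo_orbit: "closed {(\<delta>, t, x, y). pseudo_orbit \<delta> bs t x y \<and> t \<le> B}"
proof (induction bs)
  case Nil
  have "closed {p. flows_to H (fst (snd p)) (fst (snd (snd p))) (snd (snd (snd p)))}"
    by (intro closed_flows_to_preimage continuous_intros)
  moreover have "closed {p :: real \<times> real \<times> 'a \<times> 'a. fst (snd p) \<le> B}"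
    by (intro closed_Collect_le continuous_intros)
  ultimately have "closed ({p. flows_to H (fst (snd p)) (fst (snd (snd p))) (snd (snd (snd p)))} \<inter>
      {p :: real \<times> real \<times> 'a \<times> 'a. fst (snd p) \<le> B})"
    by (rule closed_Int)
  then show ?case by (rule back_subst[of closed]) auto
next
  case (Cons b bs)
  let ?IH = "{(\<delta>, t, x, y). pseudo_orbit \<delta> bs t x y \<and> t \<le> B}"
  let ?\<delta> = "\<lambda>pq :: (real \<times> real \<times> 'a \<times> 'a) \<times> (real \<times> 'a \<times> 'a). fst (fst pq)"
  let ?t = "\<lambda>pq :: (real \<times> real \<times> 'a \<times> 'a) \<times> (real \<times> 'a \<times> 'a). fst (snd (fst pq))"
  let ?x = "\<lambda>pq :: (real \<times> real \<times> 'a \<times> 'a) \<times> (real \<times> 'a \<times> 'a). fst (snd (snd (fst pq)))"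
  let ?y = "\<lambda>pq :: (real \<times> real \<times> 'a \<times> 'a) \<times> (real \<times> 'a \<times> 'a). snd (snd (snd (fst pq)))"
  let ?s = "\<lambda>pq :: (real \<times> real \<times> 'a \<times> 'a) \<times> (real \<times> 'a \<times> 'a). fst (snd pq)"
  let ?z = "\<lambda>pq :: (real \<times> real \<times> 'a \<times> 'a) \<times> (real \<times> 'a \<times> 'a). fst (snd (snd pq))"
  let ?w = "\<lambda>pq :: (real \<times> real \<times> 'a \<times> 'a) \<times> (real \<times> 'a \<times> 'a). snd (snd (snd pq))"
  let ?J = "{pq. faulty_jump b (?\<delta> pq) (?z pq) (?w pq)}"
  let ?R = "{pq. flows_to H (?s pq) (?x pq) (?z pq)} \<inter> ?J \<inter>
    ((\<lambda>pq. (?\<delta> pq, ?t pq - ?s pq, ?w pq, ?y pq)) -` ?IH) \<inter> {pq. ?t pq \<le> B}"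
  have "closed ?J"
  proof (cases b)
    case True
    have G: "closed (?z -` G)"
      by (intro closed_vimage closed_guard continuous_intros)
    have "continuous_on (?z -` G) (\<lambda>pq. (?\<delta> pq, ?w pq, r (?z pq)))"
      by (intro continuous_on_Pair continuous_on_compose2[OF continuous_reset, of _ ?z] continuous_intros) auto
    from closed_vimage_Int[OF closed_dist_le this G] show ?thesis
      by (rule back_subst[of closed]) (use True in \<open>auto simp: faulty_jump_def\<close>)
  next
    case False
    have "closed ((\<lambda>pq. (?\<delta> pq, ?w pq, ?z pq)) -` {(e, x, y). d x y \<le> ennreal e})"
      by (intro closed_vimage closed_dist_le continuous_intros)
    then show ?thesis by (rule back_subst[of closed]) (use False in \<open>auto simp: faulty_jump_def\<close>)
  qed
  moreover have "closed {pq. flows_to H (?s pq) (?x pq) (?z pq)}"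
    by (intro closed_flows_to_preimage continuous_intros)
  moreover have "closed ((\<lambda>pq. (?\<delta> pq, ?t pq - ?s pq, ?w pq, ?y pq)) -` ?IH)"
    by (intro closed_vimage Cons.IH continuous_intros)
  moreover have "closed {pq. ?t pq \<le> B}"
    by (intro closed_Collect_le continuous_intros)
  ultimately have "closed ?R" by (intro closed_Int)
  moreover have "compact ({0..B} \<times> (UNIV :: 'a set) \<times> (UNIV :: 'a set))"
    by (intro compact_Times compact_UNIV compact_Icc)
  ultimately have "closed {p. \<exists>q\<in>{0..B} \<times> UNIV \<times> UNIV. (p, q) \<in> ?R}"
    by (rule closed_compact_projection_param)
  moreover have "{p. \<exists>q\<in>{0..B} \<times> UNIV \<times> UNIV. (p, q) \<in> ?R} =
      {(\<delta>, t, x, y). pseudo_orbit \<delta> (b # bs) t x y \<and> t \<le> B}" (is "?A = ?B")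
  proof (intro set_eqI iffI)
    fix p assume "p \<in> ?A"
    then show "p \<in> ?B" by (cases p) auto
  next
    fix p assume p: "p \<in> ?B"
    obtain \<delta> t x y where p_eq: "p = (\<delta>, t, x, y)" by (cases p)
    obtain s z w where s: "flows_to H s x z" "pseudo_orbit \<delta> bs (t - s) w y" "t \<le> B"
      "faulty_jump b \<delta> z w"
      using p p_eq by auto
    have "s \<in> {0..B}" "t - s \<le> B"
      using flows_to_nonneg[OF s(1)] pseudo_orbit_nonneg[OF s(2)] s(3) by auto
    then have "(s, z, w) \<in> {0..B} \<times> UNIV \<times> UNIV" "(p, (s, z, w)) \<in> ?R"
      using s p_eq by simp_all
    then show "p \<in> ?A" by blast
  qed
  ultimately show ?case by simp
qed

text \<open>
The words are treated one by one: for one word, the bad pseudo-orbits with flow time in \<open>[a, B]\<close> from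
\<open>K\<close> to the complement of \<open>\<Omega>\<close> form a closed set that has no member with error \<open>0\<close>.
\<close>

lemma pseudo_orbit_shadowing_word:
  fixes \<Omega> :: "'a set"
  assumes "closed K" "open \<Omega>"
    and "\<And>x t y. x \<in> K \<Longrightarrow> reaches H (length (filter id bs)) t x y \<Longrightarrow> a \<le> t \<Longrightarrow> y \<in> \<Omega>"
  shows "\<exists>\<delta>>0. \<forall>\<delta>'\<in>{0..\<delta>}. \<forall>x\<in>K. \<forall>t\<in>{a..B}. \<forall>y. pseudo_orbit \<delta>' bs t x y \<longrightarrow> y \<in> \<Omega>"
proof -
  have "compact ({a..B} \<times> K \<times> (- \<Omega>))"
    using assms by (intro compact_Times compact_closed) (auto simp: closed_Compl)
  from compact_zero_gap[OF closed_pseudo_orbit[of bs B] this]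
  obtain \<delta> where "0 < \<delta>" "\<And>q \<delta>'. q \<in> {a..B} \<times> K \<times> (- \<Omega>) \<Longrightarrow> 0 \<le> \<delta>' \<Longrightarrow> \<delta>' \<le> \<delta> \<Longrightarrow>
      (\<delta>', q) \<notin> {(\<delta>, t, x, y). pseudo_orbit \<delta> bs t x y \<and> t \<le> B}"
    using assms(3) exact_pseudo_orbit by (smt (verit) ComplD SigmaE atLeastAtMost_iff case_prodD mem_Collect_eq)
  then show ?thesis by (intro exI[of _ \<delta>]) fastforce
qed

text \<open>
There are finitely many words of bounded length, so one error bound serves all of them.  A jump in
place counts in the length of the word but not in the time \<open>n + t\<close> of the true orbit; if there are at
most \<open>m\<close> of them, a loss of \<open>m\<close> covers the difference.
\<close>

lemma pseudo_orbit_shadowing: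
  fixes \<Omega> :: "'a set"
  assumes "closed K" "open \<Omega>"
    and late: "\<And>x n t y. x \<in> K \<Longrightarrow> reaches H n t x y \<Longrightarrow> a \<le> real n + t \<Longrightarrow> y \<in> \<Omega>"
  shows "\<exists>\<delta>>0. \<forall>bs t. \<forall>x\<in>K. \<forall>y. length bs \<le> k \<longrightarrow> length (filter Not bs) \<le> m \<longrightarrow> t \<le> B \<longrightarrow>
    a + real m \<le> real (length bs) + t \<longrightarrow> pseudo_orbit \<delta> bs t x y \<longrightarrow> y \<in> \<Omega>"
proof -
  define words where "words = {bs :: bool list. set bs \<subseteq> UNIV \<and> length bs \<le> k}"
  have fin: "finite words" unfolding words_def by (rule finite_lists_length_le) simp
  have ne: "words \<noteq> {}" unfolding words_def by (auto intro: exI[of _ "[]"])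
  have "\<exists>\<delta>>0. \<forall>\<delta>'\<in>{0..\<delta>}. \<forall>x\<in>K. \<forall>t\<in>{a - real (length (filter id bs))..B}. \<forall>y.
      pseudo_orbit \<delta>' bs t x y \<longrightarrow> y \<in> \<Omega>" for bs
    by (rule pseudo_orbit_shadowing_word[OF assms(1,2)], rule late) auto
  then obtain \<Delta> where \<Delta>: "\<And>bs. 0 < \<Delta> bs"
    "\<And>bs \<delta>' x t y. \<delta>' \<in> {0..\<Delta> bs} \<Longrightarrow> x \<in> K \<Longrightarrow> t \<in> {a - real (length (filter id bs))..B} \<Longrightarrow>
      pseudo_orbit \<delta>' bs t x y \<Longrightarrow> y \<in> \<Omega>"
    by metis
  define \<delta> where "\<delta> = Min (\<Delta> ` words)"
  have "0 < \<delta>" using fin ne \<Delta>(1) by (auto simp: \<delta>_def)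
  moreover have "y \<in> \<Omega>" if "x \<in> K" "length bs \<le> k" "length (filter Not bs) \<le> m" "t \<le> B"
    "a + real m \<le> real (length bs) + t" "pseudo_orbit \<delta> bs t x y" for bs t x y
  proof (rule \<Delta>(2)[of \<delta> bs x t])
    have "bs \<in> words" using that by (simp add: words_def)
    then have "\<delta> \<le> \<Delta> bs" using fin by (simp add: \<delta>_def)
    then show "\<delta> \<in> {0..\<Delta> bs}" using \<open>0 < \<delta>\<close> by simp
    have "length (filter id bs) + length (filter Not bs) = length bs"
      using sum_length_filter_compl[of id bs] by (simp add: comp_def)
    then have "real (length bs) \<le> real (length (filter id bs)) + real m" using that(3) by linarith
    then show "t \<in> {a - real (length (filter id bs))..B}" using that by simp
  qed (use that in auto)
  ultimately show ?thesis by blast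
qed

section \<open>Chains cannot leave an attracting set\<close>

lemma conley_relation_pseudo_reaches:
  assumes "conley_relation H d x y" "0 < \<epsilon>" "0 < T"
  obtains n a where "1 \<le> n" "pseudo_reaches \<epsilon> T x n a y"
proof -
  obtain c where "is_chain H d \<epsilon> T c" "chain_from_to c x y"
    using assms unfolding conley_relation_def by metis
  from chain_pseudo_reaches[OF this] that show ?thesis by auto
qed

text \<open>
Each chain has a jump, so running back and forth between \<open>x\<close> and \<open>y\<close> accumulates jumps.
\<close>

lemma pseudo_reaches_loops:
  assumes "conley_relation H d x y" "conley_relation H d y x" "0 < \<epsilon>" "0 < T"
  shows "\<exists>n\<ge>k. \<exists>a. pseudo_reaches \<epsilon> T x n a y"
proof (induction k)
  case 0
  obtain n a where "pseudo_reaches \<epsilon> T x n a y"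
    by (rule conley_relation_pseudo_reaches[OF assms(1,3,4)])
  then show ?case by auto
next
  case (Suc k)
  then obtain n a where n: "k \<le> n" "pseudo_reaches \<epsilon> T x n a y" by auto
  obtain m b where m: "1 \<le> m" "pseudo_reaches \<epsilon> T y m b x"
    by (rule conley_relation_pseudo_reaches[OF assms(2-4)])
  obtain l c where l: "pseudo_reaches \<epsilon> T x l c y"
    by (rule conley_relation_pseudo_reaches[OF assms(1,3,4)])
  obtain b' where "pseudo_reaches \<epsilon> T x (n + m) b' x" using pseudo_reaches_trans[OF m(2) n(2)] by auto
  from pseudo_reaches_trans[OF l this] show ?case using n m by (intro exI[of _ "n + m + l"]) auto
qed

text \<open>
Suppose that \<open>y\<close> is not in \<open>A\<close>, hence not in some tail \<open>C\<close> of the orbits of a trapping set \<open>U\<close>.  Choose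
a closed neighbourhood \<open>Z\<close> of \<open>C\<close> within the interior of \<open>U\<close> and without \<open>y\<close>.  After a bounded
time \<open>S\<close>, orbits from \<open>x\<close> or from \<open>Z\<close> are in the interior of \<open>Z\<close>, and so are pseudo-orbits with small error of duration between
\<open>S\<close> and \<open>2 * S + 1\<close>.  A long chain from \<open>x\<close> is cut into windows of duration about \<open>S\<close>; by
induction each cut lies in \<open>Z\<close>.  The chain may end shortly after the last cut, in a state that need not
be in \<open>Z\<close> as seen from there.  Therefore the last two cuts \<open>b\<close> and \<open>p\<close> are
remembered: seen from \<open>b\<close>, the present state is always late enough to be in \<open>Z\<close>.

Errors at resets are permitted at any time and are counted by the window.  Jumps in place are
separated by time \<open>S\<close>, which is longer than a window, so each window contains at most one of them.
\<close>

lemma chain_equivalent_in_attractor: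
  assumes A: "attracting_set H A" and x: "x \<notin> dual_repelling_set H A"
    and xy: "conley_relation H d x y" "conley_relation H d y x"
  shows "y \<in> A"
proof (rule ccontr)
  assume "y \<notin> A"
  obtain U T0 where U: "trapping_set H U" "A = omega_limit H U" and T0: "0 < T0"
      "omega_tail H U T0 \<subseteq> interior U"
    using A by (auto simp: attracting_set_def trapping_set_def)
  obtain T1' where T1': "0 < T1'" "y \<notin> omega_tail H U T1'"
    using \<open>y \<notin> A\<close> U by (auto simp: omega_limit_def)
  define T1 where "T1 = max T0 T1'"
  define C where "C = omega_tail H U T1"
  have tail_mono: "omega_tail H U S' \<subseteq> omega_tail H U S" if "S \<le> S'" for S S'
    unfolding omega_tail_reaches using that by (intro closure_mono) force
  have C: "closed C" "C \<subseteq> interior U - {y}"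
    using tail_mono[of T0 T1] tail_mono[of T1' T1] T0 T1'
    by (auto simp: C_def T1_def omega_tail_def)
  obtain Z where Z: "closed Z" "C \<subseteq> interior Z" "Z \<subseteq> interior U - {y}"
    using closed_neighbourhood[OF C(1) _ C(2)] open_Diff[OF open_interior closed_point] by metis
  \<comment> \<open>A point of the limit set of \<open>x\<close> is inside the trapping set, so the orbit of \<open>x\<close> enters it.\<close>
  obtain p where p: "p \<in> omega_limit H {x}" "p \<in> A" using x by (auto simp: dual_repelling_set_def)
  have "p \<in> interior U" using p(2) T0 U by (auto simp: omega_limit_def)
  moreover have "p \<in> omega_tail H {x} 1" using p(1) by (auto simp: omega_limit_def)
  ultimately obtain n0 t0 u where u: "u \<in> interior U" "reaches H n0 t0 x u"
    unfolding omega_tail_reaches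
    using open_Int_closure_eq_empty[OF open_interior, of U "{y. \<exists>x\<in>{x}. \<exists>n t. reaches H n t x y \<and> 1 \<le> real n + t}"]
    by blast
  define a where "a = T1 + real n0 + t0"
  have late: "q \<in> interior Z" if "b \<in> insert x Z" "reaches H n t b q" "a \<le> real n + t" for b n t q
  proof -
    have "\<exists>v\<in>U. \<exists>n t. reaches H n t v q \<and> T1 \<le> real n + t"
    proof (cases "b \<in> Z")
      case True
      then have "b \<in> U" using Z(3) interior_subset by blast
      moreover have "T1 \<le> real n + t" using that(3) reaches_nonneg[OF u(2)] by (simp add: a_def)
      ultimately show ?thesis using that(2) by blast
    next
      case False
      then have "reaches H n t x q" using that by simp
      from reaches_remainder[OF u(2) this] have "n0 \<le> n" "reaches H (n - n0) (t - t0) u q"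
        using that(3) T0 by (auto simp: a_def T1_def)
      moreover have "T1 \<le> real (n - n0) + (t - t0)" using that(3) \<open>n0 \<le> n\<close> by (simp add: a_def)
      moreover have "u \<in> U" using u interior_subset by blast
      ultimately show ?thesis by blast
    qed
    then have "q \<in> C" unfolding C_def omega_tail_reaches by (rule subsetD[OF closure_subset, OF CollectI])
    then show ?thesis using Z(2) by blast
  qed
  \<comment> \<open>\<open>S\<close> is at least \<open>a + 2\<close>, where the summand \<open>2\<close> pays for one jump in place in each of two consecutive
    windows.\<close>
  define S where "S = nat \<lceil>a\<rceil> + 3"
  have S: "a + 2 \<le> real S" "0 < real S" unfolding S_def by linarith+
  have closed_start: "closed (insert x Z)" using Z(1) closed_point[of x] closed_Un[of "{x}" Z] by simp
  have "\<exists>\<delta>>0. \<forall>bs t. \<forall>b\<in>insert x Z. \<forall>q. length bs \<le> 2 * S + 2 \<longrightarrow> length (filter Not bs) \<le> 2 \<longrightarrow>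
      t \<le> 2 * real S + 2 \<longrightarrow> a + real 2 \<le> real (length bs) + t \<longrightarrow> pseudo_orbit \<delta> bs t b q \<longrightarrow>
      q \<in> interior Z"
    by (rule pseudo_orbit_shadowing[OF closed_start open_interior]) (erule (2) late)
  then obtain \<delta> where \<delta>: "0 < \<delta>" and shadow: "\<And>bs t b q. b \<in> insert x Z \<Longrightarrow> length bs \<le> 2 * S + 2 \<Longrightarrow>
      length (filter Not bs) \<le> 2 \<Longrightarrow> t \<le> 2 * real S + 2 \<Longrightarrow> a + 2 \<le> real (length bs) + t \<Longrightarrow>
      pseudo_orbit \<delta> bs t b q \<Longrightarrow> q \<in> interior Z"
    by (metis of_nat_numeral)
  \<comment> \<open>A jump in place within a window is recent; a second one is therefore not yet permitted.\<close>
  define recent where "recent bs t age \<longleftrightarrow>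
      filter Not bs = [] \<or> length (filter Not bs) = 1 \<and> age \<le> t" for bs and t age :: real
  define window where "window w n b q age \<longleftrightarrow>
      (\<exists>bs t. pseudo_orbit \<delta> bs t b q \<and> length bs = n \<and> real n + t < w \<and> recent bs t age)"
    for w n b q age
  \<comment> \<open>In the first alternative the window starts at \<open>x\<close> and counts all jumps of the chain; it
    is excluded once there are \<open>S\<close> jumps.\<close>
  define tracked where "tracked n q age \<longleftrightarrow> window (real S) n x q age \<or>
      (\<exists>b\<in>insert x Z. \<exists>p\<in>Z. \<exists>bs t m. pseudo_orbit \<delta> bs t b p \<and> length (filter Not bs) \<le> 1 \<and>
         real S \<le> real (length bs) + t \<and> real (length bs) + t < real S + 1 \<and>
         window (real S) m p q age)"
    for n q age
  have window_restart: "window (real S) 0 q q age" for q age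
    unfolding window_def using S(2) by (intro exI[of _ "[]"] exI[of _ 0]) (simp add: recent_def)
  have advance: "window (real S) n b q age \<or>
      (q \<in> Z \<and> (\<exists>bs t. pseudo_orbit \<delta> bs t b q \<and> length (filter Not bs) \<le> 1 \<and>
         real S \<le> real (length bs) + t \<and> real (length bs) + t < real S + 1))"
    if win: "window (real S + 1) n b q age" and b: "b \<in> insert x Z" for n b q age
  proof -
    obtain bs t where w: "pseudo_orbit \<delta> bs t b q" "length bs = n" "real n + t < real S + 1" "recent bs t age"
      using win by (auto simp: window_def)
    show ?thesis
    proof (cases "real n + t < real S")
      case True
      then show ?thesis using w by (auto simp: window_def)
    next
      case False
      have nF: "length (filter Not bs) \<le> 1" using w(4) by (auto simp: recent_def)
      have "q \<in> interior Z"
        using shadow[OF b _ _ _ _ w(1)] w nF False S pseudo_orbit_nonneg[OF w(1)] by auto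
      then have "q \<in> Z" using interior_subset by blast
      moreover have "real S \<le> real (length bs) + t \<and> real (length bs) + t < real S + 1"
        using w(2,3) False by simp
      ultimately show ?thesis using w(1) nF by blast
    qed
  qed
  have step: "tracked (n + k) q' age'"
    if tr: "tracked n q age" and win: "\<And>m b. window (real S) m b q age \<Longrightarrow> window (real S + 1) (m + k) b q' age'"
    for n k q q' age age'
    using tr unfolding tracked_def[of n]
  proof
    assume "window (real S) n x q age"
    from advance[OF win[OF this]] window_restart[of q' age'] show ?thesis unfolding tracked_def by blast
  next
    assume "\<exists>b\<in>insert x Z. \<exists>p\<in>Z. \<exists>bs t m. pseudo_orbit \<delta> bs t b p \<and> length (filter Not bs) \<le> 1 \<and>
         real S \<le> real (length bs) + t \<and> real (length bs) + t < real S + 1 \<and>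
         window (real S) m p q age"
    then obtain b p bs t m where b: "b \<in> insert x Z" "p \<in> Z" "pseudo_orbit \<delta> bs t b p"
      "length (filter Not bs) \<le> 1" "real S \<le> real (length bs) + t" "real (length bs) + t < real S + 1"
      "window (real S) m p q age" by blast
    from advance[OF win[OF b(7)]] b window_restart[of q' age'] show ?thesis unfolding tracked_def by blast
  qed
  have invariant: "tracked n q age" if "pseudo_reaches \<delta> (real S) x n age q" for n q age
    using that
  proof (induction rule: pseudo_reaches.induct)
    case start
    show ?case using window_restart by (simp add: tracked_def)
  next
    case (flow n age p t q)
    have "tracked (n + 0) q (age + t)"
    proof (rule step[OF flow.IH])
      fix m b assume "window (real S) m b p age"
      then obtain bs s where w: "pseudo_orbit \<delta> bs s b p" "length bs = m" "real m + s < real S" "recent bs s age"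
        by (auto simp: window_def)
      have "pseudo_orbit \<delta> bs (s + t) b q" using pseudo_orbit_trans[OF w(1), of "[]" t q] flow.hyps by simp
      then show "window (real S + 1) (m + 0) b q (age + t)"
        unfolding window_def using w flow.hyps by (intro exI[of _ bs] exI[of _ "s + t"]) (auto simp: recent_def)
    qed
    then show ?case by simp
  next
    case (reset n age g w)
    have "tracked (n + 1) w age"
    proof (rule step[OF reset.IH])
      fix m b assume "window (real S) m b g age"
      then obtain bs s where s: "pseudo_orbit \<delta> bs s b g" "length bs = m" "real m + s < real S" "recent bs s age"
        by (auto simp: window_def)
      have "pseudo_orbit \<delta> (bs @ [True]) s b w"
        by (rule pseudo_orbit_append_jump[OF s(1)]) (use reset.hyps in \<open>simp add: faulty_jump_def\<close>)
      then show "window (real S + 1) (m + 1) b w age"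
        unfolding window_def using s by (intro exI[of _ "bs @ [True]"] exI[of _ s]) (auto simp: recent_def)
    qed
    then show ?case by simp
  next
    case (jump n age z w)
    have "tracked (n + 1) w 0"
    proof (rule step[OF jump.IH])
      fix m b assume "window (real S) m b z age"
      then obtain bs s where s: "pseudo_orbit \<delta> bs s b z" "length bs = m" "real m + s < real S" "recent bs s age"
        by (auto simp: window_def)
      have "pseudo_orbit \<delta> (bs @ [False]) s b w"
        by (rule pseudo_orbit_append_jump[OF s(1)]) (use jump.hyps in \<open>simp add: faulty_jump_def\<close>)
      moreover have "filter Not bs = []" using s jump.hyps by (auto simp: recent_def)
      ultimately show "window (real S + 1) (m + 1) b w 0"
        unfolding window_def using s pseudo_orbit_nonneg[OF s(1)]
        by (intro exI[of _ "bs @ [False]"] exI[of _ s]) (auto simp: recent_def)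
    qed
    then show ?case by simp
  qed
  obtain n age where n: "S \<le> n" "pseudo_reaches \<delta> (real S) x n age y"
    using pseudo_reaches_loops[OF xy \<delta>, of "real S" S] S(2) by auto
  have "\<not> window (real S) n x y age"
    using n(1) pseudo_orbit_nonneg by (fastforce simp: window_def)
  then obtain b p bs t m where b: "b \<in> insert x Z" "pseudo_orbit \<delta> bs t b p"
      "length (filter Not bs) \<le> 1" "real S \<le> real (length bs) + t" "real (length bs) + t < real S + 1"
      "window (real S) m p y age"
    using invariant[OF n(2)] unfolding tracked_def by blast
  then obtain cs s where s: "pseudo_orbit \<delta> cs s p y" "real (length cs) + s < real S" "recent cs s age"
    by (auto simp: window_def)
  have "length (filter Not cs) \<le> 1" using s(3) by (auto simp: recent_def)
  then have "y \<in> interior Z"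
    using shadow[OF b(1) _ _ _ _ pseudo_orbit_trans[OF b(2) s(1)]] b(3-5) s(2) S
      pseudo_orbit_nonneg[OF b(2)] pseudo_orbit_nonneg[OF s(1)] by auto
  then show False using Z(3) interior_subset[of Z] by blast
qed

lemma attracting_set_disjoint_dual: "attracting_set H A \<Longrightarrow> x \<in> A \<Longrightarrow> x \<notin> dual_repelling_set H A"
proof -
  assume A: "attracting_set H A" "x \<in> A"
  then obtain U T where U: "A = omega_limit H U" "0 < T" "omega_tail H U T \<subseteq> interior U"
    by (auto simp: attracting_set_def trapping_set_def)
  then have "x \<in> interior U" using A(2) by (auto simp: omega_limit_def)
  then have "x \<in> U" using interior_subset by blast
  moreover have "reaches H 0 0 x x" by simp
  ultimately have "omega_limit H {x} \<subseteq> A" unfolding U(1) by (intro omega_limit_reaches_mono)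
  then show ?thesis using omega_limit_nonempty[of x] by (auto simp: dual_repelling_set_def)
qed

end

theorem theorem1:
  fixes H :: "'a::topological_space hybrid_system"
    and d :: "'a \<Rightarrow> 'a \<Rightarrow> ennreal"
  assumes "metric_hybrid_system H d"
    and "deterministic H"
    and "\<forall>x. \<exists>e\<in>executions_from H x. infinite_execution e \<or> zeno_execution e"
    and "trapping_guard H"
    and "compact (UNIV :: 'a set)"
  shows "chain_recurrent_set H d = \<Inter>{A \<union> dual_repelling_set H A | A. attracting_set H A} \<and>
    (\<forall>x y. chain_equivalent H d x y \<longleftrightarrow>
      (\<forall>A B. attracting_repelling_pair H A B \<longrightarrow> (x \<in> A \<and> y \<in> A) \<or> (x \<in> B \<and> y \<in> B)))"
proof -
  interpret conley_hybrid_system d H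
    using assms by unfold_locales (auto simp: metric_hybrid_system_def)
  have "x \<in> chain_recurrent_set H d \<longleftrightarrow> (\<forall>A. attracting_set H A \<longrightarrow> x \<in> A \<union> dual_repelling_set H A)" for x
    unfolding chain_recurrent_set_def
    using separating_attractor[of x x] chain_equivalent_in_attractor[of _ x x] by blast
  then have "chain_recurrent_set H d = \<Inter>{A \<union> dual_repelling_set H A | A. attracting_set H A}"
    by blast
  moreover have "chain_equivalent H d x y \<longleftrightarrow>
      (\<forall>A B. attracting_repelling_pair H A B \<longrightarrow> (x \<in> A \<and> y \<in> A) \<or> (x \<in> B \<and> y \<in> B))" for x y
    unfolding chain_equivalent_def attracting_repelling_pair_def
  proof (intro iffI allI impI)
    fix A B assume xy: "conley_relation H d x y \<and> conley_relation H d y x"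
      and AB: "attracting_set H A \<and> B = dual_repelling_set H A"
    then show "x \<in> A \<and> y \<in> A \<or> x \<in> B \<and> y \<in> B"
      using chain_equivalent_in_attractor[of A x y] chain_equivalent_in_attractor[of A y x]
        attracting_set_disjoint_dual[of A] by blast
  next
    assume "\<forall>A B. attracting_set H A \<and> B = dual_repelling_set H A \<longrightarrow> x \<in> A \<and> y \<in> A \<or> x \<in> B \<and> y \<in> B"
    then show "conley_relation H d x y \<and> conley_relation H d y x"
      using separating_attractor[of x y] separating_attractor[of y x] by blast
  qed
  ultimately show ?thesis by blast
qed

end
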